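(* When normalized by its mean and variance, the distribution of $\deg(\nu)$ for $\nu \in \mathscr{C}_n$ converges to the standard normal distribution as $n \to \infty$. That is, for $n \geq 5$ let $\mu_n$ and $\sigma_n^2$ be the mean and variance of $\deg(\nu)$ for $\nu$ uniformly distributed on $\mathscr{C}_n$, and let $X_n = (\deg(\nu)-\mu_n)/\sigma_n$, where $\sigma_n>0$ is the square root of $\sigma_n^2$. Then $X_n \to \mathcal{N}(0,1)$ in distribution as $n \to \infty$.
   Context: $\mathscr{S}_n$ is the group of all permutations of $\{1,\ldots,n\}$ and $\mathscr{C}_n \subset \mathscr{S}_n$ is the set of all $n$-cycles, equipped with the uniform probability measure. For $\nu \in \mathscr{S}_n$ the degree is $\deg(\nu) = \#\{ i : \nu(i) > \nu(i+1)\}$, where $i$ ranges over $\{1,\ldots,n\}$ taken modulo $n$, so that $i=n$ is counted exactly when $\nu(n)>\nu(1)$. $\mathcal{N}(0,1)$ denotes a normally distributed random variable with mean $0$ and variance $1$. *)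

theory Defs
  imports "HOL-Probability.Probability" "HOL-Combinatorics.Orbits"
begin

text \<open>
  The permutations of \<open>{1, \<dots>, n}\<close> are the functions \<open>\<nu>\<close> with \<open>\<nu> permutes {1..n}\<close>; such a
  function is the identity outside \<open>{1..n}\<close>.
\<close>

definition n_cycles :: "nat \<Rightarrow> (nat \<Rightarrow> nat) set" where
  "n_cycles n = {\<nu>. \<nu> permutes {1..n} \<and> cyclic_on \<nu> {1..n}}"

text \<open>
  For \<open>i \<in> {1..n}\<close>, the term \<open>i mod n + 1\<close> is the cyclic successor of \<open>i\<close>: it is \<open>i + 1\<close> if
  \<open>i < n\<close> and \<open>1\<close> if \<open>i = n\<close>.
\<close>

definition deg :: "nat \<Rightarrow> (nat \<Rightarrow> nat) \<Rightarrow> nat" where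
  "deg n \<nu> = card {i \<in> {1..n}. \<nu> i > \<nu> (i mod n + 1)}"

text \<open>
  The set \<open>n_cycles n\<close> is finite, and it is nonempty for \<open>n \<ge> 1\<close>, so that \<open>pmf_of_set\<close> is the
  uniform distribution on it.  For \<open>n = 0\<close> it is empty and \<open>pmf_of_set\<close> is unspecified.
\<close>

definition cycle_pmf :: "nat \<Rightarrow> (nat \<Rightarrow> nat) pmf" where
  "cycle_pmf n = pmf_of_set (n_cycles n)"

definition deg_mean :: "nat \<Rightarrow> real" where
  "deg_mean n = measure_pmf.expectation (cycle_pmf n) (\<lambda>\<nu>. real (deg n \<nu>))"

definition deg_variance :: "nat \<Rightarrow> real" where
  "deg_variance n = measure_pmf.variance (cycle_pmf n) (\<lambda>\<nu>. real (deg n \<nu>))"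

definition normalized_deg :: "nat \<Rightarrow> (nat \<Rightarrow> nat) \<Rightarrow> real" where
  "normalized_deg n \<nu> = (real (deg n \<nu>) - deg_mean n) / sqrt (deg_variance n)"

end

theory Submission
  imports Defs
begin

text \<open>
  The degree is the number of cyclic descents, so the statement is a central limit theorem for cyclic
  descents of a random \<open>n\<close>-cycle.  It is reached by comparing three random variables whose mean square
  distances are of smaller order than \<open>n\<close>.

  The first one is a sum of independent uniform variables.  Let \<open>V\<^sub>1, \<dots>, V\<^sub>n\<close> be independent and uniform
  on \<open>[0, 1]\<close>, and let \<open>W\<^sub>n = V\<^sub>n + #{i < n. V\<^sub>i > V\<^sub>i\<^sub>+\<^sub>1}\<close>.  The increment \<open>W\<^sub>n\<^sub>+\<^sub>1 - W\<^sub>n\<close> is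
  \<open>V\<^sub>n\<^sub>+\<^sub>1 - V\<^sub>n\<close> modulo \<open>1\<close>, which is uniform whatever the value of \<open>V\<^sub>n\<close>.  Hence \<open>W\<^sub>n\<close> is distributed as
  a sum of \<open>n\<close> independent uniform variables (\<open>distr_descents_plus_last\<close>), and it obeys the classical
  central limit theorem with variance \<open>n/12\<close>.

  The second one is the number of cyclic descents of \<open>V\<^sub>1, \<dots>, V\<^sub>n\<close>.  It differs from \<open>W\<^sub>n\<close> by at most \<open>1\<close>.
  It only depends on the relative order of the \<open>V\<^sub>i\<close>, and this order is a uniformly distributed
  permutation, so it is distributed as the number of cyclic descents of a uniform permutation
  (\<open>distr_cyclic_descents_sample\<close>).

  The third one is the degree of a uniform \<open>n\<close>-cycle.  A uniform permutation of \<open>{1..n}\<close> is a product of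
  transpositions \<open>(m k\<^sub>m)\<close> with \<open>k\<^sub>m\<close> uniform on \<open>{1..m}\<close>, and choosing \<open>k\<^sub>m\<close> uniform on \<open>{1..m-1}\<close> instead
  gives a uniform \<open>n\<close>-cycle.  Both can be built with the same choices, except when \<open>k\<^sub>m = m\<close>, an event of
  probability \<open>1/m\<close> that makes at most two further values disagree.  The expected number of
  disagreements is thus of order \<open>log n\<close>; the cruder bound \<open>40 \<surd>n\<close> on its second moment
  (\<open>expectation_discrepancy_squared_le\<close>) suffices, because a disagreement
  affects at most two cyclic descents.

  Everything is transported by \<open>asymp_normal_perturb\<close>: a perturbation whose mean square is \<open>o(n)\<close>
  changes neither the asymptotics of a variance of order \<open>n\<close> nor the limits of the characteristic
  functions of the standardized variables.
\<close>

section \<open>Asymptotic normality under small perturbations\<close>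

text \<open>
  The Cauchy--Schwarz inequality.  It expresses that the quadratic form
  \<open>(s, r) \<mapsto> expectation ((s f - r g)\<^sup>2)\<close> is nonnegative.
\<close>
lemma (in prob_space)
  fixes f g :: "'a \<Rightarrow> real"
  assumes [measurable]: "f \<in> borel_measurable M" "g \<in> borel_measurable M"
    and f2: "integrable M (\<lambda>x. (f x)\<^sup>2)" and g2: "integrable M (\<lambda>x. (g x)\<^sup>2)"
  shows integrable_mult_squares: "integrable M (\<lambda>x. f x * g x)"
    and expectation_mult_le_sqrt: "expectation (\<lambda>x. f x * g x)
      \<le> sqrt (expectation (\<lambda>x. (f x)\<^sup>2)) * sqrt (expectation (\<lambda>x. (g x)\<^sup>2))"
proof -
  have bound: "norm (f x * g x) \<le> norm ((f x)\<^sup>2 + (g x)\<^sup>2)" for x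
  proof -
    have "2 * \<bar>f x\<bar> * \<bar>g x\<bar> \<le> (f x)\<^sup>2 + (g x)\<^sup>2"
      using sum_squares_bound[of "\<bar>f x\<bar>" "\<bar>g x\<bar>"] by simp
    moreover have "0 \<le> \<bar>f x\<bar> * \<bar>g x\<bar>" by simp
    ultimately show ?thesis unfolding real_norm_def abs_mult by linarith
  qed
  show fg: "integrable M (\<lambda>x. f x * g x)"
    by (rule Bochner_Integration.integrable_bound[OF Bochner_Integration.integrable_add[OF f2 g2]])
       (use bound in auto)
  define a where "a = expectation (\<lambda>x. (f x)\<^sup>2)"
  define b where "b = expectation (\<lambda>x. (g x)\<^sup>2)"
  define c where "c = expectation (\<lambda>x. f x * g x)"
  have a0: "0 \<le> a" and b0: "0 \<le> b" by (auto simp: a_def b_def)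
  have q: "0 \<le> s\<^sup>2 * a - 2 * s * r * c + r\<^sup>2 * b" for s r
  proof -
    have "0 \<le> expectation (\<lambda>x. (s * f x - r * g x)\<^sup>2)" by simp
    also have "(\<lambda>x. (s * f x - r * g x)\<^sup>2)
        = (\<lambda>x. s\<^sup>2 * (f x)\<^sup>2 - 2 * s * r * (f x * g x) + r\<^sup>2 * (g x)\<^sup>2)"
      by (simp add: fun_eq_iff power2_eq_square algebra_simps)
    also have "expectation \<dots> = s\<^sup>2 * a - 2 * s * r * c + r\<^sup>2 * b"
      using f2 g2 fg by (simp add: a_def b_def c_def)
    finally show ?thesis .
  qed
  have "c\<^sup>2 \<le> a * b"
  proof (cases "b = 0")
    case True
    have "c = 0"
    proof (rule ccontr)
      assume "c \<noteq> 0"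
      \<comment> \<open>With \<open>b = 0\<close> the form is affine in \<open>r\<close>, and this choice of \<open>r\<close> gives it the value \<open>-1\<close>.\<close>
      have "0 \<le> a - (a + 1)" using q[of 1 "(a + 1) / (2 * c)"] True \<open>c \<noteq> 0\<close> by simp
      then show False by simp
    qed
    then show ?thesis using True by simp
  next
    case False
    then have "0 < b" using b0 by simp
    \<comment> \<open>For \<open>s = 1\<close> the form is least at \<open>r = c / b\<close>; both values are scaled by \<open>b\<close>.\<close>
    have "b\<^sup>2 * a - 2 * b * c * c + c\<^sup>2 * b = b * (a * b - c\<^sup>2)"
      by (simp add: power2_eq_square algebra_simps)
    then have "0 \<le> b * (a * b - c\<^sup>2)" using q[of b c] by simp
    then show ?thesis using \<open>0 < b\<close> by (simp add: zero_le_mult_iff)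
  qed
  then have "c \<le> sqrt (a * b)" by (rule real_le_rsqrt)
  then show "expectation (\<lambda>x. f x * g x)
      \<le> sqrt (expectation (\<lambda>x. (f x)\<^sup>2)) * sqrt (expectation (\<lambda>x. (g x)\<^sup>2))"
    by (simp add: a_def b_def c_def real_sqrt_mult)
qed

lemma (in prob_space) expectation_abs_le_sqrt:
  fixes f :: "'a \<Rightarrow> real"
  assumes [measurable]: "f \<in> borel_measurable M" and f2: "integrable M (\<lambda>x. (f x)\<^sup>2)"
  shows "expectation (\<lambda>x. \<bar>f x\<bar>) \<le> sqrt (expectation (\<lambda>x. (f x)\<^sup>2))"
  using expectation_mult_le_sqrt[of "\<lambda>x. \<bar>f x\<bar>" "\<lambda>_. 1"] f2 by (simp add: prob_space)

lemma (in prob_space) integrable_iexp_real: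
  fixes f :: "'a \<Rightarrow> real"
  assumes "f \<in> borel_measurable M"
  shows "complex_integrable M (\<lambda>\<omega>. iexp (f \<omega>))"
  by (rule integrable_iexp) (use assms in auto)

lemma norm_iexp_diff_le: "norm (iexp x - iexp y) \<le> \<bar>x - y\<bar>"
proof -
  have "iexp x - iexp y = iexp y * (iexp (x - y) - 1)"
    by (simp add: exp_add[symmetric] algebra_simps)
  then have "norm (iexp x - iexp y) = norm (iexp (x - y) - 1)"
    by (simp add: norm_mult)
  also have "\<dots> \<le> \<bar>x - y\<bar>" using iexp_approx1[of "x - y" 0] by simp
  finally show ?thesis .
qed

text \<open>
  Both \<open>standardize\<close> and \<open>asymp_normal\<close> speak of laws rather than of random variables.  A statement
  about one random variable thereby applies to any other one with the same law, possibly on a different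
  probability space.
\<close>
definition standardize :: "real measure \<Rightarrow> real \<Rightarrow> real" where
  "standardize L x = (x - (\<integral>y. y \<partial>L)) / sqrt (\<integral>z. (z - (\<integral>y. y \<partial>L))\<^sup>2 \<partial>L)"

text \<open>
  The variance is of order \<open>n\<close>, and the standardized laws converge to the standard normal one in the sense
  of characteristic functions.
\<close>
definition asymp_normal :: "real \<Rightarrow> (nat \<Rightarrow> real measure) \<Rightarrow> bool" where
  "asymp_normal c L \<longleftrightarrow>
     (\<lambda>n. (\<integral>z. (z - (\<integral>y. y \<partial>L n))\<^sup>2 \<partial>L n) / real n) \<longlonglongrightarrow> c \<and>
     (\<forall>t. (\<lambda>n. \<integral>x. iexp (t * standardize (L n) x) \<partial>L n) \<longlonglongrightarrow> char std_normal_distribution t)"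

lemma asymp_normal_cong:
  assumes "asymp_normal c L" and "\<And>n. n \<ge> 1 \<Longrightarrow> L n = L' n"
  shows "asymp_normal c L'"
proof -
  have ev: "\<forall>\<^sub>F n in sequentially. L n = L' n"
    using assms(2) by (auto simp: eventually_sequentially)
  have "((\<lambda>n. (\<integral>z. (z - (\<integral>y. y \<partial>L n))\<^sup>2 \<partial>L n) / real n) \<longlonglongrightarrow> c) =
      ((\<lambda>n. (\<integral>z. (z - (\<integral>y. y \<partial>L' n))\<^sup>2 \<partial>L' n) / real n) \<longlonglongrightarrow> c)"
    by (rule tendsto_cong) (use ev in eventually_elim, simp)
  moreover have "((\<lambda>n. \<integral>x. iexp (t * standardize (L n) x) \<partial>L n) \<longlonglongrightarrow> l) =
      ((\<lambda>n. \<integral>x. iexp (t * standardize (L' n) x) \<partial>L' n) \<longlonglongrightarrow> l)" for t l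
    by (rule tendsto_cong) (use ev in eventually_elim, simp)
  ultimately show ?thesis using assms(1) unfolding asymp_normal_def by blast
qed

text \<open>
  Let \<open>x\<close>, \<open>y\<close> be the centred variables and \<open>a\<close>, \<open>b\<close> their standard deviations.  Expanding squares gives
  \<open>E (x/a - y/b)\<^sup>2 = (E (x - y)\<^sup>2 - (a - b)\<^sup>2) / (a b)\<close>.  This is at most \<open>E (X - Y)\<^sup>2 / (a b)\<close>, which bounds
  the distance of the characteristic functions because \<open>iexp\<close> is \<open>1\<close>-Lipschitz.  The bound on \<open>\<bar>a - b\<bar>\<close> is
  the Cauchy--Schwarz inequality for \<open>x\<close> and \<open>y\<close>.
\<close>
lemma (in prob_space)
  fixes X Y :: "'a \<Rightarrow> real"
  assumes [measurable]: "X \<in> borel_measurable M" "Y \<in> borel_measurable M"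
    and X2: "integrable M (\<lambda>\<omega>. (X \<omega>)\<^sup>2)" and Y2: "integrable M (\<lambda>\<omega>. (Y \<omega>)\<^sup>2)"
  shows sqrt_variance_diff_le: "\<bar>sqrt (variance X) - sqrt (variance Y)\<bar>
      \<le> sqrt (expectation (\<lambda>\<omega>. (X \<omega> - Y \<omega>)\<^sup>2))"
    and char_standardized_diff_le: "variance X > 0 \<Longrightarrow> variance Y > 0 \<Longrightarrow>
      norm (expectation (\<lambda>\<omega>. iexp (t * ((X \<omega> - expectation X) / sqrt (variance X)))) -
            expectation (\<lambda>\<omega>. iexp (t * ((Y \<omega> - expectation Y) / sqrt (variance Y)))))
      \<le> \<bar>t\<bar> * sqrt (expectation (\<lambda>\<omega>. (X \<omega> - Y \<omega>)\<^sup>2) / (sqrt (variance X) * sqrt (variance Y)))"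
proof -
  define x where "x = (\<lambda>\<omega>. X \<omega> - expectation X)"
  define y where "y = (\<lambda>\<omega>. Y \<omega> - expectation Y)"
  define a where "a = sqrt (variance X)"
  define b where "b = sqrt (variance Y)"
  define c where "c = expectation (\<lambda>\<omega>. x \<omega> * y \<omega>)"
  define d where "d = expectation (\<lambda>\<omega>. (X \<omega> - Y \<omega>)\<^sup>2)"
  have [measurable]: "x \<in> borel_measurable M" "y \<in> borel_measurable M" by (auto simp: x_def y_def)
  have X1: "integrable M X" and Y1: "integrable M Y"
    using X2 Y2 by (auto intro: square_integrable_imp_integrable)
  have XY: "integrable M (\<lambda>\<omega>. X \<omega> * Y \<omega>)" by (rule integrable_mult_squares) (use X2 Y2 in auto)
  have x2: "integrable M (\<lambda>\<omega>. (x \<omega>)\<^sup>2)" and y2: "integrable M (\<lambda>\<omega>. (y \<omega>)\<^sup>2)"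
    using X1 Y1 X2 Y2 by (auto simp: x_def y_def power2_diff)
  have xy: "integrable M (\<lambda>\<omega>. x \<omega> * y \<omega>)" by (rule integrable_mult_squares) (use x2 y2 in auto)
  have a2: "a\<^sup>2 = expectation (\<lambda>\<omega>. (x \<omega>)\<^sup>2)" and b2: "b\<^sup>2 = expectation (\<lambda>\<omega>. (y \<omega>)\<^sup>2)"
    and a0: "a \<ge> 0" and b0: "b \<ge> 0"
    by (auto simp: a_def b_def x_def y_def)
  have c_le: "c \<le> a * b"
  proof -
    have "c \<le> sqrt (a\<^sup>2) * sqrt (b\<^sup>2)"
      unfolding a2 b2 c_def by (rule expectation_mult_le_sqrt) (use x2 y2 in auto)
    then show ?thesis using a0 b0 by simp
  qed
  have lin: "expectation (\<lambda>\<omega>. (s * x \<omega> - r * y \<omega>)\<^sup>2) = s\<^sup>2 * a\<^sup>2 - 2 * s * r * c + r\<^sup>2 * b\<^sup>2"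
    "integrable M (\<lambda>\<omega>. (s * x \<omega> - r * y \<omega>)\<^sup>2)" for s r
  proof -
    have eq: "(\<lambda>\<omega>. (s * x \<omega> - r * y \<omega>)\<^sup>2)
        = (\<lambda>\<omega>. s\<^sup>2 * (x \<omega>)\<^sup>2 - 2 * s * r * (x \<omega> * y \<omega>) + r\<^sup>2 * (y \<omega>)\<^sup>2)"
      by (simp add: fun_eq_iff power2_eq_square algebra_simps)
    show "expectation (\<lambda>\<omega>. (s * x \<omega> - r * y \<omega>)\<^sup>2) = s\<^sup>2 * a\<^sup>2 - 2 * s * r * c + r\<^sup>2 * b\<^sup>2"
      "integrable M (\<lambda>\<omega>. (s * x \<omega> - r * y \<omega>)\<^sup>2)"
      unfolding eq using x2 y2 xy by (simp_all add: a2 b2 c_def)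
  qed
  have cd: "a\<^sup>2 - 2 * c + b\<^sup>2 \<le> d"
  proof -
    have D2: "integrable M (\<lambda>\<omega>. (X \<omega> - Y \<omega>)\<^sup>2)"
      using X2 Y2 XY by (simp add: power2_diff mult.assoc)
    have "a\<^sup>2 - 2 * c + b\<^sup>2 = variance (\<lambda>\<omega>. X \<omega> - Y \<omega>)"
      using lin(1)[of 1 1] X1 Y1 by (simp add: x_def y_def algebra_simps)
    also have "\<dots> = d - (expectation (\<lambda>\<omega>. X \<omega> - Y \<omega>))\<^sup>2"
      unfolding d_def by (rule variance_eq) (use X1 Y1 D2 in auto)
    finally show ?thesis by simp
  qed
  have "(a - b)\<^sup>2 \<le> d" using cd c_le by (simp add: power2_diff algebra_simps)
  then show "\<bar>sqrt (variance X) - sqrt (variance Y)\<bar>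
      \<le> sqrt (expectation (\<lambda>\<omega>. (X \<omega> - Y \<omega>)\<^sup>2))"
    using real_sqrt_le_mono by (fastforce simp: a_def b_def d_def)
  assume "variance X > 0" "variance Y > 0"
  then have ap: "a > 0" and bp: "b > 0" by (auto simp: a_def b_def)
  have sq: "expectation (\<lambda>\<omega>. (x \<omega> / a - y \<omega> / b)\<^sup>2) \<le> d / (a * b)"
  proof -
    have "expectation (\<lambda>\<omega>. (x \<omega> / a - y \<omega> / b)\<^sup>2) = 2 - 2 * c / (a * b)"
      using lin(1)[of "1 / a" "1 / b"] ap bp by (simp add: field_simps)
    also have "\<dots> = (2 * a * b - 2 * c) / (a * b)" using ap bp by (simp add: field_simps)
    also have "\<dots> \<le> d / (a * b)"
    proof (rule divide_right_mono)
      have "0 \<le> (a - b)\<^sup>2" by simp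
      then show "2 * a * b - 2 * c \<le> d" using cd by (simp add: power2_diff)
    qed (use ap bp in simp)
    finally show ?thesis .
  qed
  have si: "integrable M (\<lambda>\<omega>. (x \<omega> / a - y \<omega> / b)\<^sup>2)" using lin(2)[of "1 / a" "1 / b"] by simp
  have iexp_int: "complex_integrable M (\<lambda>\<omega>. iexp (t * (x \<omega> / a)))"
    "complex_integrable M (\<lambda>\<omega>. iexp (t * (y \<omega> / b)))"
    by (rule integrable_iexp_real, measurable)+
  have "norm (expectation (\<lambda>\<omega>. iexp (t * (x \<omega> / a))) - expectation (\<lambda>\<omega>. iexp (t * (y \<omega> / b))))
      = norm (expectation (\<lambda>\<omega>. iexp (t * (x \<omega> / a)) - iexp (t * (y \<omega> / b))))"
    by (simp only: Bochner_Integration.integral_diff[OF iexp_int])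
  also have "\<dots> \<le> expectation (\<lambda>\<omega>. \<bar>t\<bar> * \<bar>x \<omega> / a - y \<omega> / b\<bar>)"
  proof (rule order_trans[OF integral_norm_bound integral_mono])
    show "integrable M (\<lambda>\<omega>. norm (iexp (t * (x \<omega> / a)) - iexp (t * (y \<omega> / b))))"
      by (rule integrable_norm[OF Bochner_Integration.integrable_diff[OF iexp_int]])
    show "integrable M (\<lambda>\<omega>. \<bar>t\<bar> * \<bar>x \<omega> / a - y \<omega> / b\<bar>)"
      using square_integrable_imp_integrable[OF _ si] by auto
    show "norm (iexp (t * (x \<omega> / a)) - iexp (t * (y \<omega> / b))) \<le> \<bar>t\<bar> * \<bar>x \<omega> / a - y \<omega> / b\<bar>" for \<omega>
      using norm_iexp_diff_le[of "t * (x \<omega> / a)" "t * (y \<omega> / b)"]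
      by (simp only: right_diff_distrib[symmetric] abs_mult)
  qed
  also have "\<dots> = \<bar>t\<bar> * expectation (\<lambda>\<omega>. \<bar>x \<omega> / a - y \<omega> / b\<bar>)" by simp
  also have "\<dots> \<le> \<bar>t\<bar> * sqrt (d / (a * b))"
    using expectation_abs_le_sqrt[OF _ si] sq
    by (intro mult_left_mono) (auto intro: order_trans real_sqrt_le_mono)
  finally show "norm (expectation (\<lambda>\<omega>. iexp (t * ((X \<omega> - expectation X) / sqrt (variance X)))) -
            expectation (\<lambda>\<omega>. iexp (t * ((Y \<omega> - expectation Y) / sqrt (variance Y)))))
      \<le> \<bar>t\<bar> * sqrt (expectation (\<lambda>\<omega>. (X \<omega> - Y \<omega>)\<^sup>2) / (sqrt (variance X) * sqrt (variance Y)))"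
    by (simp only: x_def y_def a_def b_def d_def)
qed

lemma standardize_distr:
  assumes [measurable]: "X \<in> borel_measurable M"
  shows "standardize (distr M borel X) (X \<omega>) =
    (X \<omega> - (\<integral>\<omega>. X \<omega> \<partial>M)) / sqrt (\<integral>\<omega>. (X \<omega> - (\<integral>\<omega>. X \<omega> \<partial>M))\<^sup>2 \<partial>M)"
  by (simp add: standardize_def integral_distr)

lemma measurable_standardize [measurable]: "standardize L \<in> borel_measurable borel"
  unfolding standardize_def by measurable

text \<open>
  The variances of \<open>X n\<close> and \<open>Y n\<close> have the same asymptotics because standard deviations are Lipschitz for
  the mean square distance.  The characteristic functions are compared by \<open>char_standardized_diff_le\<close>,
  whose right-hand side tends to \<open>0\<close> once everything is divided by \<open>n\<close>.
\<close>
lemma asymp_normal_perturb: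
  fixes M :: "nat \<Rightarrow> 'a measure" and X Y :: "nat \<Rightarrow> 'a \<Rightarrow> real"
  assumes normal: "asymp_normal c (\<lambda>n. distr (M n) borel (X n))" and c: "c > 0"
    and ps: "\<And>n. n \<ge> 1 \<Longrightarrow> prob_space (M n)"
    and mX: "\<And>n. n \<ge> 1 \<Longrightarrow> X n \<in> borel_measurable (M n)"
    and mY: "\<And>n. n \<ge> 1 \<Longrightarrow> Y n \<in> borel_measurable (M n)"
    and X2: "\<And>n. n \<ge> 1 \<Longrightarrow> integrable (M n) (\<lambda>\<omega>. (X n \<omega>)\<^sup>2)"
    and Y2: "\<And>n. n \<ge> 1 \<Longrightarrow> integrable (M n) (\<lambda>\<omega>. (Y n \<omega>)\<^sup>2)"
    and close: "(\<lambda>n. (\<integral>\<omega>. (X n \<omega> - Y n \<omega>)\<^sup>2 \<partial>M n) / real n) \<longlonglongrightarrow> 0"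
  shows "asymp_normal c (\<lambda>n. distr (M n) borel (Y n))"
proof -
  define vX where "vX n = (\<integral>\<omega>. (X n \<omega> - (\<integral>\<omega>. X n \<omega> \<partial>M n))\<^sup>2 \<partial>M n)" for n
  define vY where "vY n = (\<integral>\<omega>. (Y n \<omega> - (\<integral>\<omega>. Y n \<omega> \<partial>M n))\<^sup>2 \<partial>M n)" for n
  define \<epsilon> where "\<epsilon> n = (\<integral>\<omega>. (X n \<omega> - Y n \<omega>)\<^sup>2 \<partial>M n)" for n
  define \<phi> where "\<phi> n t = (\<integral>\<omega>. iexp (t * ((X n \<omega> - (\<integral>\<omega>. X n \<omega> \<partial>M n)) / sqrt (vX n))) \<partial>M n)" for n t
  define \<psi> where "\<psi> n t = (\<integral>\<omega>. iexp (t * ((Y n \<omega> - (\<integral>\<omega>. Y n \<omega> \<partial>M n)) / sqrt (vY n))) \<partial>M n)" for n t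
  let ?L = "\<lambda>n. distr (M n) borel (X n)" and ?K = "\<lambda>n. distr (M n) borel (Y n)"
  have Xeq: "(\<integral>z. (z - (\<integral>y. y \<partial>?L n))\<^sup>2 \<partial>?L n) = vX n"
      "(\<integral>x. iexp (t * standardize (?L n) x) \<partial>?L n) = \<phi> n t" if "n \<ge> 1" for n t
  proof -
    note [measurable] = mX[OF that]
    show "(\<integral>z. (z - (\<integral>y. y \<partial>?L n))\<^sup>2 \<partial>?L n) = vX n"
      by (simp add: integral_distr vX_def)
    have "(\<integral>x. iexp (t * standardize (?L n) x) \<partial>?L n) = (\<integral>\<omega>. iexp (t * standardize (?L n) (X n \<omega>)) \<partial>M n)"
      by (rule integral_distr) measurable
    also have "\<dots> = \<phi> n t"
      by (simp only: standardize_distr[OF mX[OF that]] \<phi>_def vX_def)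
    finally show "(\<integral>x. iexp (t * standardize (?L n) x) \<partial>?L n) = \<phi> n t" .
  qed
  have Yeq: "(\<integral>z. (z - (\<integral>y. y \<partial>?K n))\<^sup>2 \<partial>?K n) = vY n"
      "(\<integral>x. iexp (t * standardize (?K n) x) \<partial>?K n) = \<psi> n t" if "n \<ge> 1" for n t
  proof -
    note [measurable] = mY[OF that]
    show "(\<integral>z. (z - (\<integral>y. y \<partial>?K n))\<^sup>2 \<partial>?K n) = vY n"
      by (simp add: integral_distr vY_def)
    have "(\<integral>x. iexp (t * standardize (?K n) x) \<partial>?K n) = (\<integral>\<omega>. iexp (t * standardize (?K n) (Y n \<omega>)) \<partial>M n)"
      by (rule integral_distr) measurable
    also have "\<dots> = \<psi> n t"
      by (simp only: standardize_distr[OF mY[OF that]] \<psi>_def vY_def)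
    finally show "(\<integral>x. iexp (t * standardize (?K n) x) \<partial>?K n) = \<psi> n t" .
  qed
  have ge1: "\<forall>\<^sub>F n in sequentially. n \<ge> (1::nat)" by (rule eventually_ge_at_top)
  have limX: "(\<lambda>n. vX n / real n) \<longlonglongrightarrow> c"
    by (rule Lim_transform_eventually[OF normal[unfolded asymp_normal_def, THEN conjunct1]])
       (use ge1 in eventually_elim, simp only: Xeq)
  have lim\<phi>: "(\<lambda>n. \<phi> n t) \<longlonglongrightarrow> char std_normal_distribution t" for t
    by (rule Lim_transform_eventually[OF normal[unfolded asymp_normal_def, THEN conjunct2, THEN spec]])
       (use ge1 in eventually_elim, simp only: Xeq)
  have sX: "(\<lambda>n. sqrt (vX n) / sqrt (real n)) \<longlonglongrightarrow> sqrt c"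
    using tendsto_real_sqrt[OF limX] by (simp add: real_sqrt_divide)
  have s\<epsilon>: "(\<lambda>n. sqrt (\<epsilon> n) / sqrt (real n)) \<longlonglongrightarrow> 0"
    using tendsto_real_sqrt[OF close] by (simp add: real_sqrt_divide \<epsilon>_def)
  have "(\<lambda>n. sqrt (vX n) / sqrt (real n) - sqrt (vY n) / sqrt (real n)) \<longlonglongrightarrow> 0"
  proof (rule Lim_null_comparison[OF _ s\<epsilon>])
    show "\<forall>\<^sub>F n in sequentially. norm (sqrt (vX n) / sqrt (real n) - sqrt (vY n) / sqrt (real n))
        \<le> sqrt (\<epsilon> n) / sqrt (real n)"
      using ge1
    proof eventually_elim
      case (elim n)
      have "\<bar>sqrt (vX n) - sqrt (vY n)\<bar> \<le> sqrt (\<epsilon> n)"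
        unfolding vX_def vY_def \<epsilon>_def
        by (rule prob_space.sqrt_variance_diff_le[OF ps mX mY X2 Y2]) (use elim in auto)
      then show ?case by (simp add: diff_divide_distrib[symmetric] divide_right_mono)
    qed
  qed
  from tendsto_diff[OF sX this] have sY: "(\<lambda>n. sqrt (vY n) / sqrt (real n)) \<longlonglongrightarrow> sqrt c"
    by simp
  have vY0: "vY n \<ge> 0" for n by (simp add: vY_def)
  have limY: "(\<lambda>n. vY n / real n) \<longlonglongrightarrow> c"
    using tendsto_power[OF sY, of 2] c vY0 by (simp add: power_divide)
  have posX: "\<forall>\<^sub>F n in sequentially. vX n / real n > 0"
    and posY: "\<forall>\<^sub>F n in sequentially. vY n / real n > 0"
    using order_tendstoD(1)[OF limX c] order_tendstoD(1)[OF limY c] .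
  have lim\<psi>: "(\<lambda>n. \<psi> n t) \<longlonglongrightarrow> char std_normal_distribution t" for t
  proof -
    have "(\<lambda>n. \<bar>t\<bar> * sqrt ((\<epsilon> n / real n) / ((sqrt (vX n) / sqrt (real n)) * (sqrt (vY n) / sqrt (real n)))))
        \<longlonglongrightarrow> \<bar>t\<bar> * sqrt (0 / (sqrt c * sqrt c))"
      by (intro tendsto_intros sX sY close[folded \<epsilon>_def]) (use c in auto)
    then have z: "(\<lambda>n. \<bar>t\<bar> * sqrt ((\<epsilon> n / real n) / ((sqrt (vX n) / sqrt (real n)) * (sqrt (vY n) / sqrt (real n)))))
        \<longlonglongrightarrow> 0" by simp
    have "(\<lambda>n. \<phi> n t - \<psi> n t) \<longlonglongrightarrow> 0"
    proof (rule Lim_null_comparison[OF _ z])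
      show "\<forall>\<^sub>F n in sequentially. norm (\<phi> n t - \<psi> n t) \<le>
        \<bar>t\<bar> * sqrt ((\<epsilon> n / real n) / ((sqrt (vX n) / sqrt (real n)) * (sqrt (vY n) / sqrt (real n))))"
        using ge1 posX posY
      proof eventually_elim
        case (elim n)
        have p: "vX n > 0" "vY n > 0" using elim by (auto simp: zero_less_divide_iff)
        have "norm (\<phi> n t - \<psi> n t) \<le> \<bar>t\<bar> * sqrt (\<epsilon> n / (sqrt (vX n) * sqrt (vY n)))"
          unfolding \<phi>_def \<psi>_def \<epsilon>_def vX_def vY_def
          by (rule prob_space.char_standardized_diff_le[OF ps mX mY X2 Y2])
             (use elim p in \<open>auto simp: vX_def vY_def\<close>)
        also have "\<epsilon> n / (sqrt (vX n) * sqrt (vY n)) =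
            (\<epsilon> n / real n) / ((sqrt (vX n) / sqrt (real n)) * (sqrt (vY n) / sqrt (real n)))"
          using elim p by (simp add: field_simps)
        finally show ?case .
      qed
    qed
    from tendsto_diff[OF lim\<phi>[of t] this] show ?thesis by simp
  qed
  show ?thesis
    unfolding asymp_normal_def
  proof (intro conjI allI)
    show "(\<lambda>n. (\<integral>z. (z - (\<integral>y. y \<partial>?K n))\<^sup>2 \<partial>?K n) / real n) \<longlonglongrightarrow> c"
      by (rule Lim_transform_eventually[OF limY]) (use ge1 in eventually_elim, simp only: Yeq)
    show "(\<lambda>n. \<integral>x. iexp (t * standardize (?K n) x) \<partial>?K n) \<longlonglongrightarrow> char std_normal_distribution t" for t
      by (rule Lim_transform_eventually[OF lim\<psi>]) (use ge1 in eventually_elim, simp only: Yeq)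
  qed
qed

section \<open>Cyclic descents and disagreements\<close>

definition cyclic_descents :: "nat \<Rightarrow> (nat \<Rightarrow> 'a::linorder) \<Rightarrow> nat" where
  "cyclic_descents n v = card {i \<in> {1..n}. v i > v (i mod n + 1)}"

lemma deg_eq_cyclic_descents: "deg n \<nu> = cyclic_descents n \<nu>"
  by (simp add: deg_def cyclic_descents_def)

lemma cyclic_descents_le: "cyclic_descents n v \<le> n"
proof -
  have "card {i \<in> {1..n}. v i > v (i mod n + 1)} \<le> card {1..n}" by (rule card_mono) auto
  then show ?thesis by (simp add: cyclic_descents_def)
qed

lemma inj_on_cyclic_successor: "inj_on (\<lambda>i. i mod n + 1) {1..n::nat}"
proof (rule inj_onI)
  fix i j assume ij: "i \<in> {1..n}" "j \<in> {1..n}" "i mod n + 1 = j mod n + 1"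
  then have "i mod n = j mod n" by simp
  then show "i = j"
    using ij(1,2) by (cases "i = n"; cases "j = n") auto
qed

text \<open>
  For two permutations of the same finite set, this is their Hamming distance.
\<close>
definition disagreements :: "(nat \<Rightarrow> 'a) \<Rightarrow> (nat \<Rightarrow> 'a) \<Rightarrow> nat" where
  "disagreements f g = card {i. f i \<noteq> g i}"

lemma disagreements_commute: "disagreements f g = disagreements g f"
  by (simp add: disagreements_def eq_commute)

text \<open>
  A cyclic descent of \<open>f\<close> at \<open>i\<close> that is not one of \<open>g\<close> forces a disagreement at \<open>i\<close> or at the cyclic
  successor of \<open>i\<close>.
\<close>
lemma cyclic_descents_le_add_disagreements:
  assumes "finite {i. f i \<noteq> g i}"
  shows "cyclic_descents n f \<le> cyclic_descents n g + 2 * disagreements f g"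
proof -
  let ?s = "\<lambda>i. i mod n + 1"
  let ?D = "{i. f i \<noteq> g i}" and ?B = "{i \<in> {1..n}. f (?s i) \<noteq> g (?s i)}"
    and ?G = "{i \<in> {1..n}. g i > g (?s i)}"
  have "card ?B \<le> card ?D"
  proof (rule card_inj_on_le)
    show "inj_on ?s ?B" by (rule inj_on_subset[OF inj_on_cyclic_successor]) auto
  qed (use assms in auto)
  moreover have "card {i \<in> {1..n}. f i > f (?s i)} \<le> card (?G \<union> (?D \<union> ?B))"
  proof (rule card_mono)
    show "finite (?G \<union> (?D \<union> ?B))" using assms by simp
    show "{i \<in> {1..n}. f i > f (?s i)} \<subseteq> ?G \<union> (?D \<union> ?B)"
    proof
      fix i assume i: "i \<in> {i \<in> {1..n}. f i > f (?s i)}"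
      show "i \<in> ?G \<union> (?D \<union> ?B)"
        using i by (cases "f i = g i"; cases "f (?s i) = g (?s i)") auto
    qed
  qed
  moreover have "card (?G \<union> (?D \<union> ?B)) \<le> card ?G + (card ?D + card ?B)"
    by (rule order_trans[OF card_Un_le add_left_mono[OF card_Un_le]])
  ultimately show ?thesis by (simp add: cyclic_descents_def disagreements_def)
qed

lemma cyclic_descents_diff_le_disagreements:
  assumes "finite {i. f i \<noteq> g i}"
  shows "\<bar>real (cyclic_descents n f) - real (cyclic_descents n g)\<bar> \<le> 2 * real (disagreements f g)"
proof -
  have "{i. g i \<noteq> f i} = {i. f i \<noteq> g i}" by auto
  then show ?thesis
    using cyclic_descents_le_add_disagreements[OF assms, of n]
      cyclic_descents_le_add_disagreements[of g f n] assms disagreements_commute[of f g]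
    by simp
qed

lemma disagreements_comp_inj:
  assumes "inj h"
  shows "disagreements (h \<circ> f) (h \<circ> g) = disagreements f g"
  using assms by (simp add: disagreements_def inj_eq)

text \<open>
  Only the two points that \<open>g\<close> sends to \<open>a\<close> and \<open>b\<close> are affected.
\<close>
lemma disagreements_transpose_le:
  assumes fin: "finite {i. f i \<noteq> g i}" and g: "bij g"
  shows "disagreements f (Transposition.transpose a b \<circ> g) \<le> disagreements f g + 2"
proof -
  have "{i. f i \<noteq> (Transposition.transpose a b \<circ> g) i} \<subseteq> {i. f i \<noteq> g i} \<union> {inv g a, inv g b}"
    using g by (auto simp: transpose_def bij_inv_eq_iff)
  then have "disagreements f (Transposition.transpose a b \<circ> g) \<le> card ({i. f i \<noteq> g i} \<union> {inv g a, inv g b})"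
    unfolding disagreements_def by (rule card_mono[rotated]) (use fin in simp)
  also have "\<dots> \<le> card {i. f i \<noteq> g i} + card {inv g a, inv g b}" by (rule card_Un_le)
  also have "card {inv g a, inv g b} \<le> 2" by (simp add: card_insert_if)
  finally show ?thesis by (simp add: disagreements_def)
qed

lemma finite_disagreements:
  assumes "\<pi> permutes S" "\<nu> permutes S" "finite S"
  shows "finite {i. \<pi> i \<noteq> \<nu> i}"
proof (rule finite_subset)
  show "{i. \<pi> i \<noteq> \<nu> i} \<subseteq> S"
    using permutes_not_in[OF assms(1)] permutes_not_in[OF assms(2)] by force
qed (rule assms(3))


section \<open>Growing cycles by transpositions\<close>

text \<open>
  This form of cyclicity is easy to transport between \<open>g\<close> and its extension by one point below: invariant
  sets correspond to each other, whereas the orbits would have to be followed step by step.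
\<close>
lemma cyclic_on_iff_no_proper_invariant_subset:
  assumes f: "f permutes S" and S: "finite S" "S \<noteq> {}"
  shows "cyclic_on f S \<longleftrightarrow> (\<forall>A\<subseteq>S. A \<noteq> {} \<longrightarrow> f ` A \<subseteq> A \<longrightarrow> A = S)"
proof
  assume cyc: "cyclic_on f S"
  show "\<forall>A\<subseteq>S. A \<noteq> {} \<longrightarrow> f ` A \<subseteq> A \<longrightarrow> A = S"
  proof (intro allI impI)
    fix A assume A: "A \<subseteq> S" "A \<noteq> {}" "f ` A \<subseteq> A"
    then obtain a where a: "a \<in> A" by auto
    have "x \<in> orbit f a \<Longrightarrow> x \<in> A" for x
      by (induction rule: orbit.induct) (use a A in auto)
    moreover have "orbit f a = S" using cyc a A(1) by (auto simp: cyclic_on_alldef)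
    ultimately show "A = S" using A(1) by auto
  qed
next
  assume inv: "\<forall>A\<subseteq>S. A \<noteq> {} \<longrightarrow> f ` A \<subseteq> A \<longrightarrow> A = S"
  obtain s where s: "s \<in> S" using S by auto
  have "x \<in> orbit f s \<Longrightarrow> x \<in> S" for x
    by (induction rule: orbit.induct) (use s permutes_in_image[OF f] in auto)
  moreover have "f ` orbit f s \<subseteq> orbit f s" by (auto intro: orbit.intros)
  moreover have "orbit f s \<noteq> {}" by (rule orbit_nonempty)
  ultimately have "orbit f s = S" using inv by blast
  then show "cyclic_on f S" using s by (auto simp: cyclic_on_def)
qed

text \<open>
  Composing with the transposition inserts \<open>a\<close> into the cycle of \<open>g\<close> through \<open>j\<close>, just before \<open>j\<close>.
\<close>
lemma cyclic_on_transpose_iff: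
  assumes g: "g permutes S" and S: "finite S" and a: "a \<notin> S" and j: "j \<in> S"
  shows "cyclic_on (Transposition.transpose a j \<circ> g) (insert a S) \<longleftrightarrow> cyclic_on g S"
proof -
  define f where "f = Transposition.transpose a j \<circ> g"
  have f: "f permutes insert a S"
    unfolding f_def using g j
    by (intro permutes_compose permutes_subset[OF g] permutes_swap_id) auto
  have ga: "g a = a" using g a by (auto simp: permutes_def)
  have fa: "f a = j" by (simp add: f_def ga)
  have fx: "f x = (if g x = j then a else g x)" if "x \<in> S" for x
  proof -
    have "g x \<noteq> a" using permutes_in_image[OF g, of x] that a by auto
    then show ?thesis by (simp add: f_def transpose_def)
  qed
  obtain i where i: "i \<in> S" "g i = j" using permutes_image[OF g] j by (metis imageE)
  have "S \<noteq> {}" using j by auto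
  show ?thesis
    unfolding f_def[symmetric]
    cyclic_on_iff_no_proper_invariant_subset[OF g S \<open>S \<noteq> {}\<close>]
    cyclic_on_iff_no_proper_invariant_subset[OF f finite.insertI[OF S] insert_not_empty]
  proof (intro iffI allI impI)
    fix A assume f_inv: "\<forall>A\<subseteq>insert a S. A \<noteq> {} \<longrightarrow> f ` A \<subseteq> A \<longrightarrow> A = insert a S"
      and A: "A \<subseteq> S" "A \<noteq> {}" "g ` A \<subseteq> A"
    \<comment> \<open>The new point \<open>a\<close> sits between \<open>i\<close> and \<open>j\<close>, so it has to join any invariant set that contains \<open>i\<close>.\<close>
    define B where "B = (if i \<in> A then insert a A else A)"
    have "B \<subseteq> insert a S" "B \<noteq> {}" using A by (auto simp: B_def)
    moreover have "f ` B \<subseteq> B"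
    proof safe
      fix x assume x: "x \<in> B"
      show "f x \<in> B"
      proof (cases "x = a")
        case True
        then have "i \<in> A" using x a A(1) by (auto simp: B_def split: if_splits)
        then show ?thesis using True fa i A(3) by (auto simp: B_def)
      next
        case False
        then have xA: "x \<in> A" using x by (auto simp: B_def split: if_splits)
        then have "g x = j \<Longrightarrow> x = i" using i permutes_inj[OF g] by (auto dest: injD)
        moreover have "x \<in> S" "g x \<in> A" using xA A by auto
        ultimately show ?thesis using xA fx[of x] by (cases "g x = j") (auto simp: B_def)
      qed
    qed
    ultimately have "B = insert a S" using f_inv by blast
    then show "A = S" using A(1) a by (auto simp: B_def split: if_splits)
  next
    fix A assume g_inv: "\<forall>A\<subseteq>S. A \<noteq> {} \<longrightarrow> g ` A \<subseteq> A \<longrightarrow> A = S"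
      and A: "A \<subseteq> insert a S" "A \<noteq> {}" "f ` A \<subseteq> A"
    define B where "B = A - {a}"
    have aj: "a \<in> A \<Longrightarrow> j \<in> A" using A(3) fa by auto
    have BS: "B \<subseteq> S" using A by (auto simp: B_def)
    have "B \<noteq> {}" using A(1,2) aj j a by (auto simp: B_def)
    moreover have "g ` B \<subseteq> B"
    proof safe
      fix x assume x: "x \<in> B"
      then have xS: "x \<in> S" and "f x \<in> A" using BS A(3) by (auto simp: B_def)
      moreover have "g x \<in> S" using xS permutes_in_image[OF g] by auto
      ultimately show "g x \<in> B" using fx[OF xS] aj a by (auto simp: B_def split: if_splits)
    qed
    ultimately have "B = S" using g_inv BS by blast
    then have "i \<in> A" using i by (auto simp: B_def)
    then have "a \<in> A" using A(3) fx[OF i(1)] i(2) by auto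
    then show "A = insert a S" using \<open>B = S\<close> A(1) by (auto simp: B_def)
  qed
qed

lemma finite_n_cycles: "finite (n_cycles n)"
  by (rule finite_subset[OF _ finite_permutations[of "{1..n}"]]) (auto simp: n_cycles_def)

lemma n_cycles_1: "n_cycles 1 = {id}"
proof -
  have "\<nu> permutes {1} \<longleftrightarrow> \<nu> = id" for \<nu> :: "nat \<Rightarrow> nat" by (simp add: permutes_sing)
  moreover have "cyclic_on id {1::nat}"
    by (simp add: cyclic_on_def orbit_eq_singleton_iff[THEN iffD2])
  ultimately show ?thesis by (auto simp: n_cycles_def)
qed

lemma atLeast1_atMost_Suc: "{1..Suc n} = insert (Suc n) {1..n}"
  by auto

text \<open>
  Deleting the largest point from an \<open>(n+1)\<close>-cycle leaves an \<open>n\<close>-cycle, and the image \<open>j\<close> of the largest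
  point tells where it has to be inserted again.
\<close>
lemma n_cycles_Suc:
  assumes "n \<ge> 1"
  shows "n_cycles (Suc n) = (\<Union>\<nu>\<in>n_cycles n. (\<lambda>j. Transposition.transpose (Suc n) j \<circ> \<nu>) ` {1..n})"
proof (intro equalityI subsetI)
  fix \<sigma> assume \<sigma>: "\<sigma> \<in> n_cycles (Suc n)"
  then have p: "\<sigma> permutes insert (Suc n) {1..n}" and c: "cyclic_on \<sigma> (insert (Suc n) {1..n})"
    unfolding n_cycles_def atLeast1_atMost_Suc by auto
  define j where "j = \<sigma> (Suc n)"
  define \<nu> where "\<nu> = Transposition.transpose (Suc n) j \<circ> \<sigma>"
  \<comment> \<open>Otherwise \<open>Suc n\<close> would be a fixed point, and so form an invariant set of its own.\<close>
  have "j \<noteq> Suc n"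
  proof
    assume j: "j = Suc n"
    have "\<forall>A\<subseteq>insert (Suc n) {1..n}. A \<noteq> {} \<longrightarrow> \<sigma> ` A \<subseteq> A \<longrightarrow> A = insert (Suc n) {1..n}"
      using cyclic_on_iff_no_proper_invariant_subset[OF p] c by simp
    from this[rule_format, of "{Suc n}"] have "{Suc n} = insert (Suc n) {1..n}" 
      using j by (simp add: j_def)
    moreover have "1 \<in> insert (Suc n) {1..n}" using assms by simp
    ultimately have "1 \<in> {Suc n}" by blast
    then show False using assms by simp
  qed
  moreover have "j \<in> insert (Suc n) {1..n}" unfolding j_def permutes_in_image[OF p] by simp
  ultimately have j: "j \<in> {1..n}" by auto
  have \<nu>: "\<nu> permutes {1..n}" unfolding \<nu>_def j_def by (rule permutes_insert_lemma[OF p])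
  have eq: "\<sigma> = Transposition.transpose (Suc n) j \<circ> \<nu>" by (simp add: \<nu>_def fun_eq_iff o_assoc)
  have "cyclic_on \<nu> {1..n}"
    using c cyclic_on_transpose_iff[OF \<nu> _ _ j, of "Suc n"] by (simp add: eq[symmetric])
  then show "\<sigma> \<in> (\<Union>\<nu>\<in>n_cycles n. (\<lambda>j. Transposition.transpose (Suc n) j \<circ> \<nu>) ` {1..n})"
    using \<nu> j eq by (auto simp: n_cycles_def)
next
  fix \<sigma> assume "\<sigma> \<in> (\<Union>\<nu>\<in>n_cycles n. (\<lambda>j. Transposition.transpose (Suc n) j \<circ> \<nu>) ` {1..n})"
  then obtain \<nu> j where \<nu>: "\<nu> permutes {1..n}" "cyclic_on \<nu> {1..n}" and j: "j \<in> {1..n}"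
    and eq: "\<sigma> = Transposition.transpose (Suc n) j \<circ> \<nu>"
    by (auto simp: n_cycles_def)
  have "cyclic_on \<sigma> {1..Suc n}"
    unfolding eq atLeast1_atMost_Suc using cyclic_on_transpose_iff[OF \<nu>(1) _ _ j, of "Suc n"] \<nu>(2) by simp
  moreover have "\<sigma> permutes {1..Suc n}"
    unfolding eq atLeast1_atMost_Suc
    using j by (intro permutes_compose permutes_subset[OF \<nu>(1)] permutes_swap_id) auto
  ultimately show "\<sigma> \<in> n_cycles (Suc n)" by (simp add: n_cycles_def)
qed

lemma n_cycles_nonempty: "n \<ge> 1 \<Longrightarrow> n_cycles n \<noteq> {}"
proof (induction n rule: nat_induct_at_least)
  case base
  show ?case using n_cycles_1 by auto
next
  case (Suc n)
  then show ?case using n_cycles_Suc[of n] by auto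
qed

lemma permutations_Suc:
  "{\<pi>. \<pi> permutes {1..Suc n}} = 
     (\<Union>\<pi>\<in>{\<pi>. \<pi> permutes {1..n}}. (\<lambda>j. Transposition.transpose (Suc n) j \<circ> \<pi>) ` {1..Suc n})"
  (is "?P = ?Q")
proof -
  have "?P = (\<lambda>(j, \<pi>). Transposition.transpose (Suc n) j \<circ> \<pi>) `
      {(j, \<pi>). j \<in> {1..Suc n} \<and> \<pi> \<in> {\<pi>. \<pi> permutes {1..n}}}"
    unfolding atLeast1_atMost_Suc by (rule permutes_insert)
  also have "\<dots> = ?Q" by (rule set_eqI) (simp only: image_iff UN_iff Bex_def mem_Collect_eq split_paired_Ex case_prod_conv, blast)
  finally show ?thesis .
qed

text \<open>
  The value at \<open>Suc n\<close> recovers \<open>j\<close>, and then \<open>\<pi>\<close> is recovered as well.  So the extensions of different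
  permutations are different, and each permutation has the same number of them.
\<close>
lemma pmf_of_set_transpose:
  assumes P: "\<And>\<pi>. \<pi> \<in> P \<Longrightarrow> \<pi> permutes {1..n}" "finite P" "P \<noteq> {}" and J: "finite J" "J \<noteq> {}"
  shows "pmf_of_set (\<Union>\<pi>\<in>P. (\<lambda>j. Transposition.transpose (Suc n) j \<circ> \<pi>) ` J) =
    do {\<pi> \<leftarrow> pmf_of_set P; j \<leftarrow> pmf_of_set J; return_pmf (Transposition.transpose (Suc n) j \<circ> \<pi>)}"
proof -
  let ?f = "\<lambda>\<pi> j. Transposition.transpose (Suc n) j \<circ> \<pi>"
  have at: "?f \<pi> j (Suc n) = j" if "\<pi> \<in> P" for \<pi> j
    using P(1)[OF that] by (auto simp: permutes_def transpose_def)
  have inj: "inj_on (?f \<pi>) J" if "\<pi> \<in> P" for \<pi>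
    by (rule inj_on_inverseI[where g = "\<lambda>\<sigma>. \<sigma> (Suc n)"]) (rule at[OF that])
  have "pmf_of_set (\<Union>\<pi>\<in>P. ?f \<pi> ` J) = do {\<pi> \<leftarrow> pmf_of_set P; pmf_of_set (?f \<pi> ` J)}"
  proof (rule pmf_of_set_UN)
    show "card (?f \<pi> ` J) = card J" if "\<pi> \<in> P" for \<pi> by (rule card_image[OF inj[OF that]])
    show "disjoint_family_on (\<lambda>\<pi>. ?f \<pi> ` J) P"
      unfolding disjoint_family_on_def
    proof (intro ballI impI)
      fix \<pi> \<sigma> assume ps: "\<pi> \<in> P" "\<sigma> \<in> P" "\<pi> \<noteq> \<sigma>"
      have "\<pi> = \<sigma>" if "?f \<pi> j = ?f \<sigma> k" for j k
      proof -
        have "j = k" using at ps that by metis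
        then have "Transposition.transpose (Suc n) j \<circ> (?f \<pi> j) = Transposition.transpose (Suc n) j \<circ> (?f \<sigma> j)" using that by simp
        then show ?thesis by (simp add: o_assoc)
      qed
      then show "?f \<pi> ` J \<inter> ?f \<sigma> ` J = {}" using ps(3) by blast
    qed
  qed (use P J in auto)
  also have "\<dots> = do {\<pi> \<leftarrow> pmf_of_set P; j \<leftarrow> pmf_of_set J; return_pmf (?f \<pi> j)}"
    by (intro bind_pmf_cong refl)
       (use P J inj in \<open>auto simp: map_pmf_of_set_inj[symmetric] map_pmf_def set_pmf_of_set\<close>)
  finally show ?thesis .
qed

section \<open>Coupling a permutation with a cycle\<close>

definition permutations_pmf :: "nat \<Rightarrow> (nat \<Rightarrow> nat) pmf" where
  "permutations_pmf n = pmf_of_set {\<pi>. \<pi> permutes {1..n}}"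

text \<open>
  The permutation is extended by means of \<open>k\<close>, uniform on \<open>{1..Suc n}\<close>.  The cycle uses the same \<open>k\<close>,
  unless \<open>k = Suc n\<close>: this choice would close a second cycle, and it is replaced by an independent one.
\<close>
fun coupling_step :: "nat \<Rightarrow> (nat \<Rightarrow> nat) \<times> (nat \<Rightarrow> nat) \<Rightarrow> ((nat \<Rightarrow> nat) \<times> (nat \<Rightarrow> nat)) pmf" where
  "coupling_step n (\<pi>, \<nu>) = do {
     j \<leftarrow> pmf_of_set {1..n};
     k \<leftarrow> pmf_of_set {1..Suc n};
     return_pmf (Transposition.transpose (Suc n) k \<circ> \<pi>,
       Transposition.transpose (Suc n) (if k = Suc n then j else k) \<circ> \<nu>)}"

text \<open>
  A joint law of two permutations of \<open>{1..n}\<close>, whose marginals are uniform on all permutations and on all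
  \<open>n\<close>-cycles.  The recursion really starts at \<open>n = 1\<close>, where the identity is the only permutation and is a
  cycle; there is no cycle on the empty set, and the value at \<open>0\<close> is a dummy.
\<close>
fun coupling :: "nat \<Rightarrow> ((nat \<Rightarrow> nat) \<times> (nat \<Rightarrow> nat)) pmf" where
  "coupling 0 = return_pmf (id, id)"
| "coupling (Suc n) = (if n = 0 then return_pmf (id, id) else coupling n \<bind> coupling_step n)"

text \<open>
  The shared choice has the right law for the cycle too: each \<open>i \<le> n\<close> arises directly with probability
  \<open>1/(n+1)\<close>, and from resampling with probability \<open>1/(n(n+1))\<close>.
\<close>
lemma uniform_with_top_resampled:
  assumes "n \<ge> 1"
  shows "do {j \<leftarrow> pmf_of_set {1..n}; k \<leftarrow> pmf_of_set {1..Suc n};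
    return_pmf (if k = Suc n then j else k)} = pmf_of_set {1..n}"
proof (rule pmf_eqI)
  fix i
  have *: "(\<Sum>k = 1..Suc n. indicator {i} (if k = Suc n then j else k)) = 
      (indicator {1..n} i + indicator {i} j :: real)" for j
    by (auto simp: indicator_def)
  have **: "(\<Sum>j = 1..n. indicator {i} j) = (indicator {1..n} i :: real)"
    by (auto simp: indicator_def)
  have "pmf (do {j \<leftarrow> pmf_of_set {1..n}; k \<leftarrow> pmf_of_set {1..Suc n};
      return_pmf (if k = Suc n then j else k)}) i =
    (\<Sum>j = 1..n. (\<Sum>k = 1..Suc n. indicator {i} (if k = Suc n then j else k)) / (n + 1)) / n"
    using assms by (simp add: pmf_bind_pmf_of_set pmf_return del: sum.cl_ivl_Suc) 
  also have "\<dots> = (real n * indicator {1..n} i + indicator {1..n} i) / ((real n + 1) * real n)"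
    unfolding * ** sum_divide_distrib[symmetric] sum.distrib by simp
  also have "\<dots> = pmf (pmf_of_set {1..n}) i"
    using assms by (simp add: field_simps add_nonneg_eq_0_iff)
  finally show "pmf (do {j \<leftarrow> pmf_of_set {1..n}; k \<leftarrow> pmf_of_set {1..Suc n};
      return_pmf (if k = Suc n then j else k)}) i = pmf (pmf_of_set {1..n}) i" .
qed

lemma map_fst_coupling:
  assumes "n \<ge> 1"
  shows "map_pmf fst (coupling n) = permutations_pmf n"
  using assms
proof (induction n rule: nat_induct_at_least)
  case base
  have "{\<pi>. \<pi> permutes {Suc 0..Suc 0}} = {id}" by (auto simp: permutes_sing)
  then show ?case by (simp add: permutations_pmf_def pmf_of_set_singleton)
next
  case (Suc n)
  have "map_pmf fst (coupling (Suc n)) = do {\<pi> \<leftarrow> map_pmf fst (coupling n);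
      k \<leftarrow> pmf_of_set {1..Suc n}; return_pmf (Transposition.transpose (Suc n) k \<circ> \<pi>)}"
    using Suc.hyps
    by (auto simp: map_bind_pmf bind_map_pmf split_beta' intro!: bind_pmf_cong
        simp del: set_pmf_of_set)
  also have "\<dots> = permutations_pmf (Suc n)"
    unfolding Suc.IH unfolding permutations_pmf_def permutations_Suc
    by (rule pmf_of_set_transpose[symmetric]) (auto intro: finite_permutations permutes_id)
  finally show ?case .
qed

lemma map_snd_coupling:
  assumes "n \<ge> 1"
  shows "map_pmf snd (coupling n) = cycle_pmf n"
  using assms
proof (induction n rule: nat_induct_at_least)
  case base
  show ?case by (simp add: cycle_pmf_def n_cycles_1[simplified] pmf_of_set_singleton)
next
  case (Suc n)
  have step: "map_pmf snd (coupling_step n p) = do {i \<leftarrow> pmf_of_set {1..n};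
      return_pmf (Transposition.transpose (Suc n) i \<circ> snd p)}" for p
  proof -
    obtain \<pi> \<nu> where p: "p = (\<pi>, \<nu>)" by (cases p)
    have "do {i \<leftarrow> pmf_of_set {1..n}; return_pmf (Transposition.transpose (Suc n) i \<circ> snd p)} =
      do {i \<leftarrow> do {j \<leftarrow> pmf_of_set {1..n}; k \<leftarrow> pmf_of_set {1..Suc n};
            return_pmf (if k = Suc n then j else k)};
          return_pmf (Transposition.transpose (Suc n) i \<circ> snd p)}"
      by (simp only: uniform_with_top_resampled[OF Suc.hyps])
    then show ?thesis by (simp add: p map_bind_pmf bind_assoc_pmf bind_return_pmf)
  qed
  have "map_pmf snd (coupling (Suc n)) = do {\<nu> \<leftarrow> map_pmf snd (coupling n);
      i \<leftarrow> pmf_of_set {1..n}; return_pmf (Transposition.transpose (Suc n) i \<circ> \<nu>)}"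
    using Suc.hyps by (simp add: map_bind_pmf bind_map_pmf step)
  also have "\<dots> = cycle_pmf (Suc n)"
    unfolding Suc.IH unfolding cycle_pmf_def n_cycles_Suc[OF Suc.hyps]
    by (rule pmf_of_set_transpose[symmetric])
       (use Suc.hyps n_cycles_nonempty finite_n_cycles in \<open>auto simp: n_cycles_def\<close>)
  finally show ?case .
qed

lemma set_pmf_coupling:
  assumes "n \<ge> 1" "(\<pi>, \<nu>) \<in> set_pmf (coupling n)"
  shows "\<pi> permutes {1..n}" "\<nu> permutes {1..n}"
proof -
  have "\<pi> \<in> set_pmf (map_pmf fst (coupling n))" "\<nu> \<in> set_pmf (map_pmf snd (coupling n))"
    using assms(2) by force+
  moreover have "set_pmf (permutations_pmf n) = {\<pi>. \<pi> permutes {1..n}}"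
    unfolding permutations_pmf_def
    by (rule set_pmf_of_set) (auto intro: finite_permutations permutes_id)
  moreover have "set_pmf (cycle_pmf n) = n_cycles n"
    unfolding cycle_pmf_def
    by (rule set_pmf_of_set) (use assms n_cycles_nonempty finite_n_cycles in auto)
  ultimately show "\<pi> permutes {1..n}" "\<nu> permutes {1..n}"
    using assms by (auto simp: map_fst_coupling map_snd_coupling n_cycles_def)
qed

lemma finite_set_pmf_coupling:
  "n \<ge> 1 \<Longrightarrow> finite (set_pmf (coupling n))"
  by (rule finite_subset[of _ "{\<pi>. \<pi> permutes {1..n}} \<times> {\<pi>. \<pi> permutes {1..n}}"])
     (auto simp del: One_nat_def dest: set_pmf_coupling intro: finite_permutations)

abbreviation discrepancy :: "(nat \<Rightarrow> 'a) \<times> (nat \<Rightarrow> 'a) \<Rightarrow> nat" where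
  "discrepancy p \<equiv> disagreements (fst p) (snd p)"

text \<open>
  A left multiplication by one and the same transposition does not change the set of disagreements.  Only
  the choice \<open>k = Suc n\<close>, of probability \<open>1/(n+1)\<close>, can create disagreements, and it creates at most two.
\<close>
lemma expectation_coupling_step_le:
  fixes f :: "nat \<Rightarrow> real"
  assumes n: "n \<ge> 1" and f: "mono f" and p: "p \<in> set_pmf (coupling n)"
  shows "measure_pmf.expectation (coupling_step n p) (\<lambda>p. f (discrepancy p)) \<le>
    f (discrepancy p) + (f (discrepancy p + 2) - f (discrepancy p)) / (real n + 1)"
proof -
  obtain \<pi> \<nu> where p_eq: "p = (\<pi>, \<nu>)" by (cases p)
  have perm: "\<pi> permutes {1..n}" "\<nu> permutes {1..n}" using set_pmf_coupling n p by (auto simp: p_eq)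
  let ?t = "Transposition.transpose (Suc n)"
  define d where "d = disagreements \<pi> \<nu>"
  define e where "e j k = disagreements (?t k \<circ> \<pi>) (?t (if k = Suc n then j else k) \<circ> \<nu>)" for j k
  have e1: "e j k = d" if "k \<in> {1..n}" for j k
    using that by (simp add: e_def d_def disagreements_comp_inj)
  have e2: "e j (Suc n) \<le> d + 2" for j
    unfolding e_def d_def
    using disagreements_transpose_le[OF finite_disagreements[OF perm], of "Suc n" j] permutes_bij[OF perm(2)]
    by simp
  have inner: "(\<Sum>k = 1..Suc n. f (e j k)) \<le> (real n + 1) * f d + (f (d + 2) - f d)" for j
  proof -
    have "(\<Sum>k = 1..Suc n. f (e j k)) = (\<Sum>k = 1..n. f (e j k)) + f (e j (Suc n))" by simp
    also have "(\<Sum>k = 1..n. f (e j k)) = real n * f d" by (simp add: e1)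
    also have "f (e j (Suc n)) \<le> f (d + 2)" using f e2 by (auto dest: monoD)
    finally show ?thesis by (simp add: algebra_simps)
  qed
  have "measure_pmf.expectation (coupling_step n p) (\<lambda>p. f (discrepancy p)) =
      (\<Sum>j = 1..n. (\<Sum>k = 1..Suc n. f (e j k)) / (real n + 1)) / real n"
    using n unfolding p_eq coupling_step.simps
    by (subst pmf_expectation_bind_pmf_of_set)
       (auto simp: pmf_expectation_bind_pmf_of_set e_def sum_divide_distrib divide_inverse
          sum_distrib_right sum_distrib_left mult_ac add_ac simp del: sum.cl_ivl_Suc)
  also have "\<dots> \<le> (\<Sum>j = 1..n. ((real n + 1) * f d + (f (d + 2) - f d)) / (real n + 1)) / real n"
    by (intro divide_right_mono sum_mono inner) auto
  also have "\<dots> = f d + (f (d + 2) - f d) / (real n + 1)"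
    using n by (simp add: add_divide_distrib)
  finally show ?thesis by (simp add: d_def p_eq)
qed

lemma expectation_coupling_Suc_le:
  fixes f :: "nat \<Rightarrow> real"
  assumes n: "n \<ge> 1" and f: "mono f"
  shows "measure_pmf.expectation (coupling (Suc n)) (\<lambda>p. f (discrepancy p)) \<le>
    measure_pmf.expectation (coupling n) (\<lambda>p. f (discrepancy p)) +
    measure_pmf.expectation (coupling n) (\<lambda>p. f (discrepancy p + 2) - f (discrepancy p)) / (real n + 1)"
proof -
  let ?S = "set_pmf (coupling n)"
  have fin: "finite ?S" by (rule finite_set_pmf_coupling[OF n])
  have fins: "finite (set_pmf (coupling_step n p))" for p
    using n by (cases p) auto
  have int: "integrable (measure_pmf (coupling n)) h" for h :: "_ \<Rightarrow> real"
    by (rule integrable_measure_pmf_finite[OF fin])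
  have "measure_pmf.expectation (coupling (Suc n)) (\<lambda>p. f (discrepancy p)) =
      (\<Sum>p\<in>?S. pmf (coupling n) p * measure_pmf.expectation (coupling_step n p) (\<lambda>p. f (discrepancy p)))"
    using n by (simp add: pmf_expectation_bind[OF fin fins])
  also have "\<dots> \<le> (\<Sum>p\<in>?S. pmf (coupling n) p *
      (f (discrepancy p) + (f (discrepancy p + 2) - f (discrepancy p)) / (real n + 1)))"
    by (intro sum_mono mult_left_mono expectation_coupling_step_le n f) auto
  also have "\<dots> = measure_pmf.expectation (coupling n)
      (\<lambda>p. f (discrepancy p) + (f (discrepancy p + 2) - f (discrepancy p)) / (real n + 1))"
    by (subst integral_measure_pmf[OF fin]) auto
  also have "\<dots> = measure_pmf.expectation (coupling n) (\<lambda>p. f (discrepancy p)) +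
    measure_pmf.expectation (coupling n) (\<lambda>p. f (discrepancy p + 2) - f (discrepancy p)) / (real n + 1)"
    by (subst Bochner_Integration.integral_add) (auto intro!: int)
  finally show ?thesis .
qed

text \<open>
  The bounds on the moments of the number of disagreements are telescoping sums of square roots.
\<close>
lemma sqrt_Suc_diff_ge: "1 / (2 * sqrt (real n + 1)) \<le> sqrt (real n + 1) - sqrt (real n)"
proof -
  have "(sqrt (real n + 1) - sqrt (real n)) * (sqrt (real n + 1) + sqrt (real n)) = 1"
    by (simp add: algebra_simps)
  moreover have "0 < sqrt (real n + 1) + sqrt (real n)" by (simp add: add_pos_nonneg)
  ultimately have "sqrt (real n + 1) - sqrt (real n) = 1 / (sqrt (real n + 1) + sqrt (real n))"
    by (simp add: eq_divide_eq)
  also have "\<dots> \<ge> 1 / (2 * sqrt (real n + 1))"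
  proof (rule divide_left_mono)
    show "0 < 2 * sqrt (real n + 1) * (sqrt (real n + 1) + sqrt (real n))"
      by (intro mult_pos_pos add_pos_nonneg) auto
  qed auto
  finally show ?thesis .
qed

text \<open>
  The increments \<open>2/(n+1)\<close> add up to a logarithm; a multiple of \<open>\<surd>n\<close> is a simpler bound that is still
  \<open>o(n)\<close>.
\<close>
lemma expectation_discrepancy_le:
  assumes "n \<ge> 1"
  shows "measure_pmf.expectation (coupling n) (\<lambda>p. real (discrepancy p)) \<le> 4 * sqrt (real n)"
  using assms
proof (induction n rule: nat_induct_at_least)
  case base
  show ?case by (simp add: disagreements_def)
next
  case (Suc n)
  have "measure_pmf.expectation (coupling (Suc n)) (\<lambda>p. real (discrepancy p)) \<le> 
      measure_pmf.expectation (coupling n) (\<lambda>p. real (discrepancy p)) + 2 / (real n + 1)"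
    using expectation_coupling_Suc_le[OF Suc.hyps, of real] by (simp add: mono_def del: coupling.simps)
  also have "2 / (real n + 1) \<le> 4 * (1 / (2 * sqrt (real n + 1)))"
  proof -
    have "sqrt (real n + 1) \<le> real n + 1" by (rule real_le_lsqrt) (auto simp: power2_eq_square algebra_simps)
    then show ?thesis by (simp add: frac_le)
  qed
  also have "\<dots> \<le> 4 * (sqrt (real n + 1) - sqrt (real n))"
    using sqrt_Suc_diff_ge[of n] by (intro mult_left_mono) auto
  finally show ?case using Suc.IH by (simp add: algebra_simps del: coupling.simps)
qed

text \<open>
  The square of \<open>d\<close> grows by \<open>4 d + 4\<close> when \<open>d\<close> grows by \<open>2\<close>, so the first moment controls the increments
  of the second one.
\<close>
lemma expectation_discrepancy_squared_le:
  assumes "n \<ge> 1"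
  shows "measure_pmf.expectation (coupling n) (\<lambda>p. (real (discrepancy p))\<^sup>2) \<le> 40 * sqrt (real n)"
  using assms
proof (induction n rule: nat_induct_at_least)
  case base
  show ?case by (simp add: disagreements_def)
next
  case (Suc n)
  have int: "integrable (measure_pmf (coupling n)) h" for h :: "_ \<Rightarrow> real"
    by (rule integrable_measure_pmf_finite[OF finite_set_pmf_coupling[OF Suc.hyps]])
  have "measure_pmf.expectation (coupling n) (\<lambda>p. (real (discrepancy p + 2))\<^sup>2 - (real (discrepancy p))\<^sup>2)
      = measure_pmf.expectation (coupling n) (\<lambda>p. 4 * real (discrepancy p) + 4)"
    by (intro Bochner_Integration.integral_cong) (auto simp: power2_eq_square algebra_simps)
  also have "\<dots> = 4 * measure_pmf.expectation (coupling n) (\<lambda>p. real (discrepancy p)) + 4"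
    by (subst Bochner_Integration.integral_add) (auto intro!: int)
  also have "\<dots> \<le> 20 * sqrt (real n + 1)"
    using expectation_discrepancy_le[OF Suc.hyps] real_sqrt_le_mono[of "real n" "real n + 1"]
      real_sqrt_ge_one[of "real n + 1"] by linarith
  finally have "measure_pmf.expectation (coupling n)
        (\<lambda>p. (real (discrepancy p + 2))\<^sup>2 - (real (discrepancy p))\<^sup>2) / (real n + 1)
      \<le> 20 * sqrt (real n + 1) / (real n + 1)"
    by (rule divide_right_mono) simp
  also have "\<dots> = 40 * (1 / (2 * sqrt (real n + 1)))"
  proof -
    have "20 * sqrt (real n + 1) / (real n + 1) =
        20 * sqrt (real n + 1) / (sqrt (real n + 1) * sqrt (real n + 1))"
      by simp
    also have "\<dots> = 40 * (1 / (2 * sqrt (real n + 1)))"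
      by (simp del: real_sqrt_mult_self add: add_nonneg_eq_0_iff)
    finally show ?thesis .
  qed
  also have "\<dots> \<le> 40 * (sqrt (real n + 1) - sqrt (real n))"
    using sqrt_Suc_diff_ge[of n] by (intro mult_left_mono) auto
  finally show ?case
    using expectation_coupling_Suc_le[OF Suc.hyps, of "\<lambda>d. (real d)\<^sup>2"] Suc.IH
    by (simp add: mono_def algebra_simps del: coupling.simps)
qed

section \<open>Descents of a uniform sample\<close>

definition unif :: "real measure" where
  "unif = uniform_measure lborel {0..1}"

lemma sets_unif [measurable_cong, simp]: "sets unif = sets borel"
  by (simp add: unif_def)

lemma space_unif [simp]: "space unif = UNIV"
  by (simp add: unif_def)

lemma prob_space_unif: "prob_space unif"
  unfolding unif_def by (rule prob_space_uniform_measure) auto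

interpretation unif: real_distribution unif
  using prob_space_unif by (simp add: real_distribution_def real_distribution_axioms_def)

interpretation unif_product: product_sigma_finite "\<lambda>_::nat. unif"
  by (simp add: product_sigma_finite_def unif.sigma_finite_measure_axioms)

lemma prob_space_PiM_unif: "prob_space (PiM I (\<lambda>_::nat. unif))"
  by (rule prob_space_PiM) (rule prob_space_unif)

lemma unif_eq_density: "unif = density lborel (\<lambda>x. ennreal (indicator {0..1} x))"
  by (simp add: unif_def uniform_measure_def ennreal_indicator divide_ennreal_def)

lemma nn_integral_unif:
  assumes [measurable]: "f \<in> borel_measurable borel"
  shows "(\<integral>\<^sup>+x. f x \<partial>unif) = (\<integral>\<^sup>+x. f x * indicator {0..1} x \<partial>lborel)"
  unfolding unif_eq_density by (subst nn_integral_density) (auto simp: ennreal_indicator mult.commute)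

lemma AE_unif_iff:
  assumes [measurable]: "Measurable.pred borel P"
  shows "(AE x in unif. P x) \<longleftrightarrow> (AE x in lborel. x \<in> {0..1} \<longrightarrow> P x)"
  unfolding unif_eq_density by (subst AE_density) (auto simp: indicator_def)

lemma AE_unif_01: "AE x in unif. 0 \<le> x \<and> x \<le> 1"
  by (subst AE_unif_iff) auto

lemma nn_integral_unif_singleton: "(\<integral>\<^sup>+x. indicator {c} x \<partial>unif) = 0"
proof -
  have "(\<integral>\<^sup>+x. indicator {c} x * indicator {0..1} x \<partial>lborel) = 0"
    by (subst nn_integral_0_iff_AE)
       (use AE_lborel_singleton[of c] in \<open>auto elim!: eventually_mono simp: indicator_def\<close>)
  then show ?thesis by (subst nn_integral_unif) auto
qed

lemma unif_moment: "integral\<^sup>L unif (\<lambda>x. x ^ k) = 1 / (real k + 1)"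
proof -
  have "integral\<^sup>L unif (\<lambda>x. x ^ k) = (\<integral>x. x ^ k * indicator {0..1} x \<partial>lborel)"
    unfolding unif_eq_density by (subst integral_density) (auto simp: mult.commute)
  also have "\<dots> = 1 / (real k + 1)"
    by (subst integral_power) (auto simp: add.commute)
  finally show ?thesis .
qed

lemma integrable_unif_power: "integrable unif (\<lambda>x. x ^ k)"
proof (rule unif.integrable_const_bound[where B = 1])
  show "AE x in unif. norm (x ^ k) \<le> 1"
    using AE_unif_01 by eventually_elim (auto simp: power_le_one power_abs)
qed simp

text \<open>
  Subtraction of \<open>a\<close> modulo \<open>1\<close> moves the intervals \<open>[0, a)\<close> and \<open>[a, 1]\<close> to \<open>[1 - a, 1)\<close> and
  \<open>[0, 1 - a]\<close> by translations, hence it preserves the uniform distribution.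
\<close>
lemma distr_unif_rotate:
  assumes a: "0 \<le> a" "a \<le> 1"
  shows "distr unif borel (\<lambda>y. y - a + (if a > y then 1 else 0)) = unif"
proof (rule measure_eqI)
  fix A assume "A \<in> sets (distr unif borel (\<lambda>y. y - a + (if a > y then 1 else 0)))"
  then have [measurable]: "A \<in> sets borel" by simp
  let ?r = "\<lambda>y. y - a + (if a > y then 1 else 0)"
  let ?I = "indicator A :: real \<Rightarrow> ennreal"
  have "emeasure (distr unif borel ?r) A = (\<integral>\<^sup>+x. ?I x \<partial>distr unif borel ?r)"
    by simp
  also have "\<dots> = (\<integral>\<^sup>+y. ?I (?r y) \<partial>unif)"
    by (subst nn_integral_distr) auto
  also have "\<dots> = (\<integral>\<^sup>+y. ?I (?r y) * indicator {0..1} y \<partial>lborel)"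
    by (rule nn_integral_unif) measurable
  also have "\<dots> = (\<integral>\<^sup>+y. ?I (y - a + 1) * indicator {0..<a} y + ?I (y - a) * indicator {a..1} y \<partial>lborel)"
    by (intro nn_integral_cong) (use a in \<open>auto simp: indicator_def\<close>)
  also have "\<dots> = (\<integral>\<^sup>+y. ?I (y - a + 1) * indicator {0..<a} y \<partial>lborel) +
      (\<integral>\<^sup>+y. ?I (y - a) * indicator {a..1} y \<partial>lborel)"
    by (rule nn_integral_add) measurable
  also have "(\<integral>\<^sup>+y. ?I (y - a + 1) * indicator {0..<a} y \<partial>lborel) =
      (\<integral>\<^sup>+x. ?I x * indicator {1-a..<1} x \<partial>lborel)"
    by (subst nn_integral_real_affine[where c = 1 and t = "a - 1"])
       (auto intro!: nn_integral_cong simp: indicator_def algebra_simps)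
  also have "(\<integral>\<^sup>+y. ?I (y - a) * indicator {a..1} y \<partial>lborel) =
      (\<integral>\<^sup>+x. ?I x * indicator {0..1-a} x \<partial>lborel)"
    by (subst nn_integral_real_affine[where c = 1 and t = a])
       (auto intro!: nn_integral_cong simp: indicator_def algebra_simps)
  also have "(\<integral>\<^sup>+x. ?I x * indicator {1-a..<1} x \<partial>lborel) + (\<integral>\<^sup>+x. ?I x * indicator {0..1-a} x \<partial>lborel) =
      (\<integral>\<^sup>+x. ?I x * indicator {1-a..<1} x + ?I x * indicator {0..1-a} x \<partial>lborel)"
    by (rule nn_integral_add[symmetric]) measurable
  also have "\<dots> = (\<integral>\<^sup>+x. ?I x * indicator {0..1} x \<partial>lborel)"
    by (rule nn_integral_cong_AE)
       (use AE_lborel_singleton[of "1 - a"] AE_lborel_singleton[of "1::real"] in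
         \<open>eventually_elim, use a in \<open>auto simp: indicator_def\<close>\<close>)
  also have "\<dots> = (\<integral>\<^sup>+x. ?I x \<partial>unif)" by (rule nn_integral_unif[symmetric]) measurable
  also have "\<dots> = emeasure unif A" by simp
  finally show "emeasure (distr unif borel ?r) A = emeasure unif A" .
qed simp

text \<open>
  The total distance travelled on the circle by a point that starts at \<open>0\<close>, always moves forward, and
  visits the positions \<open>v 1, \<dots>, v n\<close> in \<open>[0, 1)\<close> in turn: it passes \<open>0\<close> once for each descent.
\<close>
definition descents_plus_last :: "nat \<Rightarrow> (nat \<Rightarrow> real) \<Rightarrow> real" where
  "descents_plus_last n v = (\<Sum>i = 1..<n. if v i > v (Suc i) then 1 else 0) + v n"

lemma cyclic_descents_eq_sum:
  "real (cyclic_descents n v) = (\<Sum>i = 1..n. if v i > v (i mod n + 1) then 1 else 0)"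
  by (simp add: cyclic_descents_def sum.If_cases Int_def conj_commute)

lemma cyclic_descents_close:
  assumes "n \<ge> 1" "0 \<le> v n" "v n \<le> 1"
  shows "\<bar>descents_plus_last n v - real (cyclic_descents n v)\<bar> \<le> 1"
proof -
  have "{1..n} = insert n {1..<n}" using assms by auto
  then have "real (cyclic_descents n v) = (\<Sum>i = 1..<n. if v i > v (i mod n + 1) then 1 else 0)
      + (if v n > v 1 then 1 else 0)"
    unfolding cyclic_descents_eq_sum by simp
  also have "(\<Sum>i = 1..<n. if v i > v (i mod n + 1) then 1 else 0) =
      (\<Sum>i = 1..<n. if v i > v (Suc i) then 1 else (0::real))"
    by (intro sum.cong) auto
  finally show ?thesis using assms by (auto simp: descents_plus_last_def)
qed

abbreviation sample :: "nat \<Rightarrow> (nat \<Rightarrow> real) measure" where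
  "sample n \<equiv> PiM {1..n} (\<lambda>_. unif)"

lemma measurable_coordinate: "i \<in> I \<Longrightarrow> (\<lambda>v. v i) \<in> borel_measurable (PiM I (\<lambda>_. unif))"
  using measurable_component_singleton[of i I "\<lambda>_. unif"] by simp

lemma measurable_descents_plus_last: 
  assumes "n \<ge> 1"
  shows "descents_plus_last n \<in> borel_measurable (sample n)"
  unfolding descents_plus_last_def[abs_def]
proof (intro borel_measurable_add borel_measurable_sum)
  show "(\<lambda>v. v n) \<in> borel_measurable (sample n)"
    by (rule measurable_coordinate) (use assms in auto)
  fix i assume i: "i \<in> {1..<n}"
  have [measurable]: "(\<lambda>v. v i) \<in> borel_measurable (sample n)" "(\<lambda>v. v (Suc i)) \<in> borel_measurable (sample n)"
    using i by (auto intro!: measurable_coordinate)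
  show "(\<lambda>v. if v i > v (Suc i) then 1 else (0::real)) \<in> borel_measurable (sample n)" by measurable
qed

lemma measurable_cyclic_descents: 
  "(\<lambda>v. real (cyclic_descents n v)) \<in> borel_measurable (sample n)"
  unfolding cyclic_descents_eq_sum
proof (intro borel_measurable_sum)
  fix i assume i: "i \<in> {1..n}"
  then have "i mod n + 1 \<in> {1..n}" by (cases "i = n") auto
  with i have [measurable]: "(\<lambda>v. v i) \<in> borel_measurable (sample n)" "(\<lambda>v. v (i mod n + 1)) \<in> borel_measurable (sample n)"
    by (auto intro!: measurable_coordinate)
  show "(\<lambda>v. if v i > v (i mod n + 1) then 1 else (0::real)) \<in> borel_measurable (sample n)" by measurable
qed

lemma AE_sample_01:
  assumes "i \<in> I"
  shows "AE v in PiM I (\<lambda>_. unif). 0 \<le> v i \<and> v i \<le> 1"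
  using AE_PiM_component[OF prob_space_unif assms AE_unif_01] by simp

text \<open>
  By induction on \<open>n\<close>, integrating over the last coordinate first.  Given the other coordinates, the
  increment is the last coordinate rotated by \<open>v n\<close>, and the integral over it does not depend on \<open>v n\<close>.
\<close>
lemma char_descents_plus_last:
  assumes "n \<ge> 1"
  shows "char (distr (sample n) borel (descents_plus_last n)) t = char unif t ^ n"
  using assms
proof (induction n rule: nat_induct_at_least)
  case base
  have "char (distr (sample 1) borel (descents_plus_last 1)) t = (\<integral>v. iexp (t * v 1) \<partial>PiM {1::nat} (\<lambda>_. unif))"
    unfolding char_def using measurable_descents_plus_last[of 1]
    by (subst integral_distr) (auto simp: descents_plus_last_def simp del: One_nat_def)
  also have "\<dots> = (\<integral>x. iexp (t * x) \<partial>unif)"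
    by (rule unif_product.product_integral_singleton) simp
  finally show ?case by (simp add: char_def)
next
  case (Suc n)
  let ?W = "descents_plus_last n" and ?W' = "descents_plus_last (Suc n)"
  have [measurable]: "?W \<in> borel_measurable (sample n)" "?W' \<in> borel_measurable (sample (Suc n))"
    by (rule measurable_descents_plus_last, use Suc.hyps in simp)+
  have set: "{1..Suc n} = insert (Suc n) {1..n}" by auto
  have rot: "(\<integral>y. iexp (t * (y - a + (if a > y then 1 else 0))) \<partial>unif) = char unif t" if "0 \<le> a" "a \<le> 1" for a
  proof -
    have "(\<integral>y. iexp (t * (y - a + (if a > y then 1 else 0))) \<partial>unif) =
        (\<integral>x. iexp (t * x) \<partial>distr unif borel (\<lambda>y. y - a + (if a > y then 1 else 0)))"
      by (rule integral_distr[symmetric]) measurable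
    then show ?thesis by (simp add: distr_unif_rotate[OF that] char_def)
  qed
  have split: "?W' (v(Suc n := y)) = ?W v + (y - v n + (if v n > y then 1 else 0))" for v y
  proof -
    have "{1..<Suc n} = insert n {1..<n}" using Suc.hyps by auto
    moreover have "(\<Sum>i = 1..<n. if (v(Suc n := y)) i > (v(Suc n := y)) (Suc i) then 1 else 0) = 
        (\<Sum>i = 1..<n. if v i > v (Suc i) then 1 else (0::real))"
      by (intro sum.cong) auto
    ultimately show ?thesis by (simp add: descents_plus_last_def)
  qed
  have "char (distr (sample (Suc n)) borel ?W') t = (\<integral>v. iexp (t * ?W' v) \<partial>sample (Suc n))"
    unfolding char_def by (rule integral_distr) measurable
  also have "\<dots> = (\<integral>v. (\<integral>y. iexp (t * ?W' (v(Suc n := y))) \<partial>unif) \<partial>sample n)"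
    unfolding set
  proof (rule unif_product.product_integral_insert)
    show "complex_integrable (PiM (insert (Suc n) {1..n}) (\<lambda>_. unif)) (\<lambda>v. iexp (t * ?W' v))"
      unfolding set[symmetric] by (rule prob_space.integrable_iexp_real[OF prob_space_PiM_unif]) measurable
  qed auto
  also have "\<dots> = (\<integral>v. iexp (t * ?W v) * char unif t \<partial>sample n)"
  proof (rule integral_cong_AE)
    have "(\<integral>y. iexp (t * ?W' (v(Suc n := y))) \<partial>unif) = iexp (t * ?W v) * char unif t"
      if "0 \<le> v n" "v n \<le> 1" for v
    proof -
      have "iexp (t * ?W' (v(Suc n := y))) =
          iexp (t * ?W v) * iexp (t * (y - v n + (if v n > y then 1 else 0)))" for y
        unfolding split by (simp add: exp_add[symmetric] algebra_simps)
      then show ?thesis by (simp only: integral_mult_right_zero rot[OF that])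
    qed
    then show "AE v in sample n. (\<integral>y. iexp (t * ?W' (v(Suc n := y))) \<partial>unif) = iexp (t * ?W v) * char unif t"
      by (intro eventually_mono[OF AE_sample_01[of n "{1..n}"]]) (use Suc.hyps in auto)
    show "(\<lambda>v. \<integral>y. iexp (t * ?W' (v(Suc n := y))) \<partial>unif) \<in> borel_measurable (sample n)"
    proof -
      have [measurable]: "(\<lambda>v. v n) \<in> borel_measurable (sample n)"
        by (rule measurable_coordinate) (use Suc.hyps in auto)
      show ?thesis unfolding split by measurable
    qed
  qed measurable
  also have "\<dots> = (\<integral>v. iexp (t * ?W v) \<partial>sample n) * char unif t" by simp
  also have "(\<integral>v. iexp (t * ?W v) \<partial>sample n) = char (distr (sample n) borel ?W) t"
    unfolding char_def by (rule integral_distr[symmetric]) measurable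
  finally show ?case by (simp only: Suc.IH power_Suc mult.commute)
qed


section \<open>From uniform samples to uniform permutations\<close>

text \<open>
  Two coordinates agree with probability \<open>0\<close>: once all coordinates but one are given, that one would have
  to take a prescribed value, and the uniform distribution has no atoms.
\<close>
lemma AE_sample_inj:
  assumes I: "finite I"
  shows "AE v in PiM I (\<lambda>_::nat. unif). inj_on v I"
proof -
  have "AE v in PiM I (\<lambda>_. unif). v i \<noteq> v j" if ij: "i \<in> I" "j \<in> I" "i \<noteq> j" for i j
  proof -
    have set: "I = insert i (I - {i})" using ij by auto
    have [measurable]: "(\<lambda>v. v i) \<in> borel_measurable (PiM I (\<lambda>_. unif))" "(\<lambda>v. v j) \<in> borel_measurable (PiM I (\<lambda>_. unif))"
      using ij by (auto intro!: measurable_coordinate)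
    have f: "(\<lambda>v. indicator {v. v i = v j} v :: ennreal) \<in> borel_measurable (PiM I (\<lambda>_. unif))"
    proof -
      have "{v \<in> space (PiM I (\<lambda>_. unif)). v i = v j} \<in> sets (PiM I (\<lambda>_. unif))"
        by (rule borel_measurable_eq) fact+
      then have "(indicator {v \<in> space (PiM I (\<lambda>_. unif)). v i = v j} :: _ \<Rightarrow> ennreal)
          \<in> borel_measurable (PiM I (\<lambda>_. unif))"
        by (rule borel_measurable_indicator)
      then show ?thesis
        by (rule measurable_cong[THEN iffD1, rotated]) (simp add: indicator_def)
    qed
    have "(\<integral>\<^sup>+v. indicator {v. v i = v j} v \<partial>PiM I (\<lambda>_. unif)) =
        (\<integral>\<^sup>+v. indicator {v. v i = v j} v \<partial>PiM (insert i (I - {i})) (\<lambda>_. unif))"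
      using set by simp
    also have "\<dots> = (\<integral>\<^sup>+v. (\<integral>\<^sup>+y. indicator {v. v i = v j} (v(i := y)) \<partial>unif) \<partial>PiM (I - {i}) (\<lambda>_. unif))"
      by (rule unif_product.product_nn_integral_insert) (use I f set in auto)
    also have "\<dots> = (\<integral>\<^sup>+v. (\<integral>\<^sup>+y. indicator {v j} y \<partial>unif) \<partial>PiM (I - {i}) (\<lambda>_. unif))"
      by (intro nn_integral_cong) (use ij in \<open>auto simp: indicator_def\<close>)
    also have "\<dots> = 0" unfolding nn_integral_unif_singleton by simp
    finally have "AE v in PiM I (\<lambda>_. unif). indicator {v. v i = v j} v = (0::ennreal)"
      using nn_integral_0_iff_AE[OF f] by simp
    then show ?thesis by (auto elim!: eventually_mono simp: indicator_def split: if_splits)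
  qed
  then have "AE v in PiM I (\<lambda>_. unif). \<forall>i\<in>I. \<forall>j\<in>I. i \<noteq> j \<longrightarrow> v i \<noteq> v j"
    using I by (intro AE_finite_allI) auto
  then show ?thesis by (auto elim!: eventually_mono simp: inj_on_def)
qed

text \<open>
  The witness sends \<open>i\<close> to the rank of \<open>v i\<close> among the values of \<open>v\<close>.
\<close>
lemma rank_permutation:
  fixes v :: "nat \<Rightarrow> real"
  assumes inj: "inj_on v {1..n}"
  obtains \<rho> where "\<rho> permutes {1..n}" and "\<And>i j. i \<in> {1..n} \<Longrightarrow> j \<in> {1..n} \<Longrightarrow> \<rho> i < \<rho> j \<longleftrightarrow> v i < v j"
proof -
  define \<rho> where "\<rho> i = (if i \<in> {1..n} then card {k \<in> {1..n}. v k \<le> v i} else i)" for i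
  have lt: "\<rho> i < \<rho> j" if "i \<in> {1..n}" "j \<in> {1..n}" "v i < v j" for i j
  proof -
    have "{k \<in> {1..n}. v k \<le> v i} \<subseteq> {k \<in> {1..n}. v k \<le> v j}"
      "j \<in> {k \<in> {1..n}. v k \<le> v j}" "j \<notin> {k \<in> {1..n}. v k \<le> v i}"
      using that by auto
    then have "{k \<in> {1..n}. v k \<le> v i} \<subset> {k \<in> {1..n}. v k \<le> v j}" by blast
    then have "card {k \<in> {1..n}. v k \<le> v i} < card {k \<in> {1..n}. v k \<le> v j}"
      by (rule psubset_card_mono[rotated]) simp
    then show ?thesis using that(1,2) by (simp add: \<rho>_def)
  qed
  have iff: "\<rho> i < \<rho> j \<longleftrightarrow> v i < v j" if "i \<in> {1..n}" "j \<in> {1..n}" for i j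
    using lt[OF that] lt[OF that(2,1)] inj_onD[OF inj _ that]
    by (metis linorder_less_linear order_less_asym)
  have "inj_on \<rho> {1..n}"
    using iff inj by (metis inj_onD inj_onI linorder_neqE_linordered_idom order_less_irrefl)
  moreover have "\<rho> ` {1..n} \<subseteq> {1..n}"
  proof safe
    fix i assume i: "i \<in> {1..n}"
    have "card {k \<in> {1..n}. v k \<le> v i} \<le> card {1..n}" by (rule card_mono) auto
    moreover have "0 < card {k \<in> {1..n}. v k \<le> v i}" using i by (subst card_gt_0_iff) auto
    ultimately show "\<rho> i \<in> {1..n}" using i by (simp add: \<rho>_def Suc_le_eq)
  qed
  ultimately have "bij_betw \<rho> {1..n} {1..n}"
    by (simp add: bij_betw_def endo_inj_surj)
  then have "\<rho> permutes {1..n}" by (rule bij_imp_permutes) (auto simp: \<rho>_def)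
  then show ?thesis using iff that by blast
qed

lemma cyclic_descents_comp_cong:
  fixes f :: "nat \<Rightarrow> 'a::linorder" and g :: "nat \<Rightarrow> 'b::linorder"
  assumes "\<sigma> permutes {1..n}" and "\<And>i j. i \<in> {1..n} \<Longrightarrow> j \<in> {1..n} \<Longrightarrow> f i < f j \<longleftrightarrow> g i < g j"
  shows "cyclic_descents n (\<lambda>i. f (\<sigma> i)) = cyclic_descents n (\<lambda>i. g (\<sigma> i))"
proof -
  have "i mod n + 1 \<in> {1..n}" if "i \<in> {1..n}" for i using that by (cases "i = n") auto
  then have "{i \<in> {1..n}. f (\<sigma> i) > f (\<sigma> (i mod n + 1))} = {i \<in> {1..n}. g (\<sigma> i) > g (\<sigma> (i mod n + 1))}"
    using permutes_in_image[OF assms(1)] assms(2) by blast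
  then show ?thesis by (simp add: cyclic_descents_def)
qed

lemma distr_sample_permute:
  assumes "\<sigma> permutes {1..n}"
  shows "distr (sample n) (sample n) (\<lambda>v. \<lambda>i\<in>{1..n}. v (\<sigma> i)) = sample n"
  using assms permutes_in_image[OF assms] permutes_inj_on[OF assms]
  by (intro distr_PiM_reindex) (auto intro: prob_space_unif)

text \<open>
  The sample is exchangeable, so a function of it may be averaged over all rearrangements of the
  coordinates.  When the coordinates are distinct, the rearrangements realise every relative order exactly
  once, and the average is the uniform average over permutations.
\<close>
lemma distr_cyclic_descents_sample:
  "distr (sample n) borel (\<lambda>v. real (cyclic_descents n v)) =
   distr (measure_pmf (permutations_pmf n)) borel (\<lambda>\<pi>. real (cyclic_descents n \<pi>))"
proof (rule measure_eqI)
  fix A assume "A \<in> sets (distr (sample n) borel (\<lambda>v. real (cyclic_descents n v)))"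
  then have A [measurable]: "A \<in> sets borel" by simp
  interpret S: prob_space "sample n" by (rule prob_space_PiM_unif)
  let ?P = "{\<pi>. \<pi> permutes {1..n}}"
  have finP: "finite ?P" and neP: "?P \<noteq> {}" by (auto intro: finite_permutations permutes_id)
  have [measurable]: "(\<lambda>v. real (cyclic_descents n v)) \<in> borel_measurable (sample n)"
    by (rule measurable_cyclic_descents)
  define h where "h k = (indicator A (real k) :: real)" for k :: nat
  have h_meas [measurable]: "(\<lambda>v. h (cyclic_descents n v)) \<in> borel_measurable (sample n)"
    unfolding h_def by measurable
  have shuffle_meas: "(\<lambda>v. \<lambda>i\<in>{1..n}. v (\<sigma> i)) \<in> measurable (sample n) (sample n)" if "\<sigma> permutes {1..n}" for \<sigma>
    by (rule measurable_restrict) (use permutes_in_image[OF that] in auto)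
  have cd_restrict: "cyclic_descents n (\<lambda>i\<in>{1..n}. f i) = cyclic_descents n f" for f :: "nat \<Rightarrow> real"
  proof -
    have "i mod n + 1 \<in> {1..n}" if "i \<in> {1..n}" for i using that by (cases "i = n") auto
    then show ?thesis unfolding cyclic_descents_def by (intro arg_cong[where f = card]) auto
  qed
  have shuffle: "S.expectation (\<lambda>v. h (cyclic_descents n (\<lambda>i. v (\<sigma> i)))) = S.expectation (\<lambda>v. h (cyclic_descents n v))"
    and shuffle_int: "integrable (sample n) (\<lambda>v. h (cyclic_descents n (\<lambda>i. v (\<sigma> i))))"
    if \<sigma>: "\<sigma> permutes {1..n}" for \<sigma>
  proof -
    have "S.expectation (\<lambda>v. h (cyclic_descents n v)) =
       (\<integral>v. h (cyclic_descents n v) \<partial>distr (sample n) (sample n) (\<lambda>v. \<lambda>i\<in>{1..n}. v (\<sigma> i)))"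
      by (simp only: distr_sample_permute[OF \<sigma>])
    also have "\<dots> = S.expectation (\<lambda>v. h (cyclic_descents n (\<lambda>i. v (\<sigma> i))))"
      by (subst integral_distr[OF shuffle_meas[OF \<sigma>] h_meas]) (simp only: cd_restrict)
    finally show "S.expectation (\<lambda>v. h (cyclic_descents n (\<lambda>i. v (\<sigma> i)))) = S.expectation (\<lambda>v. h (cyclic_descents n v))" ..
    have "(\<lambda>v. h (cyclic_descents n (\<lambda>i. v (\<sigma> i)))) \<in> borel_measurable (sample n)"
      using measurable_compose[OF shuffle_meas[OF \<sigma>] h_meas] by (simp only: cd_restrict)
    then show "integrable (sample n) (\<lambda>v. h (cyclic_descents n (\<lambda>i. v (\<sigma> i))))"
      by (intro S.integrable_const_bound[where B = 1]) (auto simp: h_def indicator_def)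
  qed
  have const: "(\<Sum>\<sigma>\<in>?P. h (cyclic_descents n (\<lambda>i. v (\<sigma> i)))) = (\<Sum>\<pi>\<in>?P. h (cyclic_descents n \<pi>))"
    if inj: "inj_on v {1..n}" for v :: "nat \<Rightarrow> real"
  proof -
    obtain \<rho> where \<rho>: "\<rho> permutes {1..n}"
      and ord: "\<And>i j. i \<in> {1..n} \<Longrightarrow> j \<in> {1..n} \<Longrightarrow> \<rho> i < \<rho> j \<longleftrightarrow> v i < v j"
      using rank_permutation[OF inj] by blast
    have "(\<Sum>\<sigma>\<in>?P. h (cyclic_descents n (\<lambda>i. v (\<sigma> i)))) = (\<Sum>\<sigma>\<in>?P. h (cyclic_descents n (\<rho> \<circ> \<sigma>)))"
    proof (rule sum.cong[OF refl])
      fix \<sigma> assume "\<sigma> \<in> ?P"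
      then have "cyclic_descents n (\<lambda>i. v (\<sigma> i)) = cyclic_descents n (\<lambda>i. \<rho> (\<sigma> i))"
        by (intro cyclic_descents_comp_cong) (auto simp: ord)
      then show "h (cyclic_descents n (\<lambda>i. v (\<sigma> i))) = h (cyclic_descents n (\<rho> \<circ> \<sigma>))" by (simp add: comp_def)
    qed
    also have "\<dots> = (\<Sum>\<pi>\<in>?P. h (cyclic_descents n \<pi>))"
      by (rule setum_permutations_compose_left[OF \<rho>, symmetric])
    finally show ?thesis .
  qed
  have "real (card ?P) * S.expectation (\<lambda>v. h (cyclic_descents n v)) = 
      (\<Sum>\<sigma>\<in>?P. S.expectation (\<lambda>v. h (cyclic_descents n (\<lambda>i. v (\<sigma> i)))))"
  proof -
    have "(\<Sum>\<sigma>\<in>?P. S.expectation (\<lambda>v. h (cyclic_descents n (\<lambda>i. v (\<sigma> i))))) =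
        (\<Sum>\<sigma>\<in>?P. S.expectation (\<lambda>v. h (cyclic_descents n v)))"
      by (rule sum.cong[OF refl]) (rule shuffle, simp)
    then show ?thesis by simp
  qed
  also have "\<dots> = S.expectation (\<lambda>v. \<Sum>\<sigma>\<in>?P. h (cyclic_descents n (\<lambda>i. v (\<sigma> i))))"
    by (rule Bochner_Integration.integral_sum[symmetric], rule shuffle_int) simp
  also have "\<dots> = S.expectation (\<lambda>v. \<Sum>\<pi>\<in>?P. h (cyclic_descents n \<pi>))"
  proof (rule integral_cong_AE)
    show "(\<lambda>v. \<Sum>\<sigma>\<in>?P. h (cyclic_descents n (\<lambda>i. v (\<sigma> i)))) \<in> borel_measurable (sample n)"
      by (intro borel_measurable_sum borel_measurable_integrable shuffle_int) auto
    show "AE v in sample n. (\<Sum>\<sigma>\<in>?P. h (cyclic_descents n (\<lambda>i. v (\<sigma> i)))) = (\<Sum>\<pi>\<in>?P. h (cyclic_descents n \<pi>))"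
      using AE_sample_inj[OF finite_atLeastAtMost] by eventually_elim (rule const)
  qed simp
  also have "\<dots> = (\<Sum>\<pi>\<in>?P. h (cyclic_descents n \<pi>))" by (simp add: S.prob_space del: One_nat_def)
  finally have eq: "S.expectation (\<lambda>v. h (cyclic_descents n v)) = (\<Sum>\<pi>\<in>?P. h (cyclic_descents n \<pi>)) / real (card ?P)"
    using finP neP by (simp add: field_simps)
  have "measure (distr (sample n) borel (\<lambda>v. real (cyclic_descents n v))) A = 
      (\<integral>x. indicator A x \<partial>distr (sample n) borel (\<lambda>v. real (cyclic_descents n v)))" by simp
  also have "\<dots> = S.expectation (\<lambda>v. h (cyclic_descents n v))"
    unfolding h_def by (rule integral_distr) measurable
  also have "\<dots> = measure_pmf.expectation (permutations_pmf n) (\<lambda>\<pi>. h (cyclic_descents n \<pi>))"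
    unfolding eq permutations_pmf_def by (rule integral_pmf_of_set[OF neP finP, symmetric])
  also have "\<dots> = (\<integral>x. indicator A x \<partial>distr (measure_pmf (permutations_pmf n)) borel (\<lambda>\<pi>. real (cyclic_descents n \<pi>)))"
    unfolding h_def by (rule integral_distr[symmetric]) measurable
  also have "\<dots> = measure (distr (measure_pmf (permutations_pmf n)) borel (\<lambda>\<pi>. real (cyclic_descents n \<pi>))) A" by simp
  finally have m: "measure (distr (sample n) borel (\<lambda>v. real (cyclic_descents n v))) A =
    measure (distr (measure_pmf (permutations_pmf n)) borel (\<lambda>\<pi>. real (cyclic_descents n \<pi>))) A" .
  interpret D1: prob_space "distr (sample n) borel (\<lambda>v. real (cyclic_descents n v))"
    by (rule S.prob_space_distr) measurable
  interpret D2: prob_space "distr (measure_pmf (permutations_pmf n)) borel (\<lambda>\<pi>. real (cyclic_descents n \<pi>))"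
    by (rule measure_pmf.prob_space_distr) measurable
  show "emeasure (distr (sample n) borel (\<lambda>v. real (cyclic_descents n v))) A =
    emeasure (distr (measure_pmf (permutations_pmf n)) borel (\<lambda>\<pi>. real (cyclic_descents n \<pi>))) A"
    unfolding D1.emeasure_eq_measure D2.emeasure_eq_measure m ..
qed simp

section \<open>The central limit theorem for sums of uniform variables\<close>

abbreviation uniform_sequence :: "(nat \<Rightarrow> real) measure" where
  "uniform_sequence \<equiv> PiM UNIV (\<lambda>_. unif)"

interpretation uniform_sequence: prob_space uniform_sequence
  by (rule prob_space_PiM_unif)

lemma distr_uniform_sequence_coordinate: "distr uniform_sequence borel (\<lambda>\<omega>. \<omega> i) = unif"
proof -
  have "distr uniform_sequence borel (\<lambda>\<omega>. \<omega> i) = distr uniform_sequence unif (\<lambda>\<omega>. \<omega> i)"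
    by (rule distr_cong) auto
  also have "\<dots> = unif" by (rule distr_PiM_component) (auto intro: prob_space_unif)
  finally show ?thesis .
qed

lemma measurable_uniform_sequence [measurable]: "(\<lambda>\<omega>. \<omega> i) \<in> borel_measurable uniform_sequence"
  by (rule measurable_coordinate) simp

lemma indep_vars_uniform_sequence:
  "uniform_sequence.indep_vars (\<lambda>_. borel) (\<lambda>i \<omega>. \<omega> i) UNIV"
proof (subst uniform_sequence.indep_vars_iff_distr_eq_PiM)
  have "distr uniform_sequence (PiM UNIV (\<lambda>_. borel)) (\<lambda>\<omega>. \<lambda>i\<in>UNIV. \<omega> i) =
      distr uniform_sequence uniform_sequence (\<lambda>\<omega>. \<omega>)"
    by (rule distr_cong) (auto intro!: sets_PiM_cong)
  then show "distr uniform_sequence (PiM UNIV (\<lambda>_. borel)) (\<lambda>\<omega>. \<lambda>i\<in>UNIV. \<omega> i) =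
      PiM UNIV (\<lambda>i. distr uniform_sequence borel (\<lambda>\<omega>. \<omega> i))"
    by (simp add: distr_uniform_sequence_coordinate)
qed auto

lemma integral_uniform_sequence_coordinate:
  fixes f :: "real \<Rightarrow> real"
  assumes f [measurable]: "f \<in> borel_measurable borel"
  shows "uniform_sequence.expectation (\<lambda>\<omega>. f (\<omega> i)) = integral\<^sup>L unif f"
    and "integrable unif f \<Longrightarrow> integrable uniform_sequence (\<lambda>\<omega>. f (\<omega> i))"
proof -
  have "uniform_sequence.expectation (\<lambda>\<omega>. f (\<omega> i)) = integral\<^sup>L (distr uniform_sequence borel (\<lambda>\<omega>. \<omega> i)) f"
    by (rule integral_distr[symmetric]) measurable
  then show "uniform_sequence.expectation (\<lambda>\<omega>. f (\<omega> i)) = integral\<^sup>L unif f"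
    by (simp add: distr_uniform_sequence_coordinate)
  have "integrable (distr uniform_sequence borel (\<lambda>\<omega>. \<omega> i)) f = integrable uniform_sequence (\<lambda>\<omega>. f (\<omega> i))"
    by (rule integrable_distr_eq) measurable
  then show "integrable unif f \<Longrightarrow> integrable uniform_sequence (\<lambda>\<omega>. f (\<omega> i))"
    by (simp add: distr_uniform_sequence_coordinate)
qed

lemma unif_centered_moments:
  "integral\<^sup>L unif (\<lambda>x. x - 1/2) = 0" "integral\<^sup>L unif (\<lambda>x. (x - 1/2)\<^sup>2) = 1/12"
  "integrable unif (\<lambda>x. x - 1/2)" "integrable unif (\<lambda>x. (x - 1/2)\<^sup>2)"
proof -
  have sq: "(\<lambda>x::real. (x - 1/2)\<^sup>2) = (\<lambda>x. x\<^sup>2 - x + 1/4)"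
    by (simp add: fun_eq_iff power2_eq_square algebra_simps)
  show "integral\<^sup>L unif (\<lambda>x. x - 1/2) = 0" "integrable unif (\<lambda>x. x - 1/2)"
    using unif_moment[of 1] integrable_unif_power[of 1] unif.prob_space by simp_all
  show "integral\<^sup>L unif (\<lambda>x. (x - 1/2)\<^sup>2) = 1/12" "integrable unif (\<lambda>x. (x - 1/2)\<^sup>2)"
    unfolding sq using unif_moment[of 1] integrable_unif_power[of 1] unif_moment[of 2] 
      integrable_unif_power[of 2] unif.prob_space by simp_all
qed

text \<open>
  The mixed terms in the square of the sum vanish by independence; this gives the variance \<open>n/12\<close>.
\<close>
lemma centered_sum_moments:
  defines "T \<equiv> \<lambda>n \<omega>. \<Sum>i<n. \<omega> i - 1/2"
  shows "integrable uniform_sequence (T n) \<and> integrable uniform_sequence (\<lambda>\<omega>. (T n \<omega>)\<^sup>2) \<and>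
    uniform_sequence.expectation (T n) = 0 \<and> uniform_sequence.expectation (\<lambda>\<omega>. (T n \<omega>)\<^sup>2) = real n / 12"
proof (induction n)
  case 0
  show ?case by (simp add: T_def)
next
  case (Suc n)
  let ?Y = "\<lambda>\<omega>::nat \<Rightarrow> real. \<omega> n - 1/2"
  have "uniform_sequence.indep_vars (\<lambda>_. borel) (\<lambda>i \<omega>. \<omega> i - 1/2) UNIV"
    by (rule uniform_sequence.indep_vars_compose2[OF indep_vars_uniform_sequence]) auto
  then have "uniform_sequence.indep_vars (\<lambda>_. borel) (\<lambda>i \<omega>. \<omega> i - 1/2) (insert n {..<n})"
    by (rule uniform_sequence.indep_vars_subset) auto
  then have indep: "uniform_sequence.indep_var borel ?Y borel (T n)"
    unfolding T_def by (intro uniform_sequence.indep_vars_sum) auto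
  have Y: "integrable uniform_sequence ?Y" "integrable uniform_sequence (\<lambda>\<omega>. (?Y \<omega>)\<^sup>2)"
    "uniform_sequence.expectation ?Y = 0" "uniform_sequence.expectation (\<lambda>\<omega>. (?Y \<omega>)\<^sup>2) = 1/12"
    using unif_centered_moments integral_uniform_sequence_coordinate[of "\<lambda>x. x - 1/2" n]
      integral_uniform_sequence_coordinate[of "\<lambda>x. (x - 1/2)\<^sup>2" n] by auto
  have YT: "integrable uniform_sequence (\<lambda>\<omega>. ?Y \<omega> * T n \<omega>)"
    "uniform_sequence.expectation (\<lambda>\<omega>. ?Y \<omega> * T n \<omega>) = 0"
    using uniform_sequence.indep_var_integrable[OF indep Y(1)]
      uniform_sequence.indep_var_lebesgue_integral[OF indep Y(1)] Suc.IH Y(3) by auto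
  have T: "T (Suc n) = (\<lambda>\<omega>. T n \<omega> + ?Y \<omega>)" by (simp add: T_def)
  have T2: "(\<lambda>\<omega>. (T (Suc n) \<omega>)\<^sup>2) = (\<lambda>\<omega>. (T n \<omega>)\<^sup>2 + 2 * (?Y \<omega> * T n \<omega>) + (?Y \<omega>)\<^sup>2)"
    by (simp add: T fun_eq_iff power2_sum)
  show ?case
    unfolding T2 unfolding T using Suc.IH Y YT by (simp add: add_divide_distrib)
qed

lemma asymp_normal_uniform_sum:
  "asymp_normal (1/12) (\<lambda>n. distr uniform_sequence borel (\<lambda>\<omega>. \<Sum>i<n. \<omega> i))"
proof -
  define S where "S n \<omega> = (\<Sum>i<n. \<omega> i)" for n and \<omega> :: "nat \<Rightarrow> real"
  have [measurable]: "S n \<in> borel_measurable uniform_sequence" for n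
    unfolding S_def[abs_def] by measurable
  have centered: "(\<Sum>i<n. \<omega> i - 1/2) = S n \<omega> - real n / 2" for n \<omega>
    by (simp add: S_def sum_subtractf)
  note moments = centered_sum_moments[unfolded centered]
  have ES: "uniform_sequence.expectation (S n) = real n / 2" for n
  proof -
    have "uniform_sequence.expectation (\<lambda>\<omega>. (S n \<omega> - real n / 2) + real n / 2) = real n / 2"
      using moments[of n] by (subst Bochner_Integration.integral_add) (auto simp: uniform_sequence.prob_space)
    then show ?thesis by simp
  qed
  have VS: "uniform_sequence.expectation (\<lambda>\<omega>. (S n \<omega> - real n / 2)\<^sup>2) = real n / 12" for n
    using moments[of n] by simp
  have std: "standardize (distr uniform_sequence borel (S n)) (S n \<omega>) = (S n \<omega> - real n / 2) / sqrt (real n / 12)" for n \<omega>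
    by (simp add: standardize_distr ES VS)
  have s2: "real n * (sqrt (1/12))\<^sup>2 = real n / 12" for n by simp
  have "weak_conv_m (\<lambda>n. distr uniform_sequence borel
      (\<lambda>\<omega>. (\<Sum>i<n. \<omega> i - 1/2) / sqrt (real n * (sqrt (1/12))\<^sup>2))) std_normal_distribution"
  proof (rule uniform_sequence.central_limit_theorem[OF indep_vars_uniform_sequence])
    show mean: "uniform_sequence.expectation (\<lambda>\<omega>. \<omega> n) = 1/2" for n
      using integral_uniform_sequence_coordinate(1)[of "\<lambda>x. x" n] unif_moment[of 1] by simp
    show "uniform_sequence.variance (\<lambda>\<omega>. \<omega> n) = (sqrt (1/12))\<^sup>2" for n
      unfolding mean using integral_uniform_sequence_coordinate(1)[of "\<lambda>x. (x - 1/2)\<^sup>2" n] unif_centered_moments(2) by simp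
    show "integrable uniform_sequence (\<lambda>\<omega>. (\<omega> n)\<^sup>2)" for n
      using integral_uniform_sequence_coordinate(2)[of "\<lambda>x. x\<^sup>2" n] integrable_unif_power[of 2] by simp
    show "distr uniform_sequence borel (\<lambda>\<omega>. \<omega> n) = unif" for n
      by (rule distr_uniform_sequence_coordinate)
  qed simp
  then have "(\<lambda>n. char (distr uniform_sequence borel (\<lambda>\<omega>. (S n \<omega> - real n / 2) / sqrt (real n / 12))) t)
      \<longlonglongrightarrow> char std_normal_distribution t" for t
    unfolding centered s2
    by (intro levy_continuity1) (auto intro: real_dist_normal_dist)
  moreover have "char (distr uniform_sequence borel (\<lambda>\<omega>. (S n \<omega> - real n / 2) / sqrt (real n / 12))) t =
      (\<integral>x. iexp (t * standardize (distr uniform_sequence borel (S n)) x) \<partial>distr uniform_sequence borel (S n))" for n t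
  proof -
    have "char (distr uniform_sequence borel (\<lambda>\<omega>. (S n \<omega> - real n / 2) / sqrt (real n / 12))) t = 
        (\<integral>\<omega>. iexp (t * ((S n \<omega> - real n / 2) / sqrt (real n / 12))) \<partial>uniform_sequence)"
      unfolding char_def by (rule integral_distr) measurable
    also have "\<dots> = (\<integral>\<omega>. iexp (t * standardize (distr uniform_sequence borel (S n)) (S n \<omega>)) \<partial>uniform_sequence)"
      by (simp only: std)
    also have "\<dots> = (\<integral>x. iexp (t * standardize (distr uniform_sequence borel (S n)) x) \<partial>distr uniform_sequence borel (S n))"
      by (rule integral_distr[symmetric]) measurable
    finally show ?thesis .
  qed
  moreover have "(\<lambda>n. (real n / 12) / real n) \<longlonglongrightarrow> 1/12"
    by (rule Lim_transform_eventually[OF tendsto_const])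
       (use eventually_gt_at_top[of 0] in \<open>eventually_elim, simp\<close>)
  ultimately have "asymp_normal (1/12) (\<lambda>n. distr uniform_sequence borel (S n))"
    unfolding asymp_normal_def by (simp add: integral_distr ES VS)
  then show ?thesis by (simp add: S_def[abs_def])
qed

text \<open>
  Both laws have the \<open>n\<close>-th power of the same characteristic function.
\<close>
lemma distr_descents_plus_last:
  assumes "n \<ge> 1"
  shows "distr (sample n) borel (descents_plus_last n) = distr uniform_sequence borel (\<lambda>\<omega>. \<Sum>i<n. \<omega> i)"
proof (rule Levy_uniqueness)
  show "real_distribution (distr (sample n) borel (descents_plus_last n))"
    by (rule prob_space.real_distribution_distr[OF prob_space_PiM_unif measurable_descents_plus_last[OF assms]])
  show "real_distribution (distr uniform_sequence borel (\<lambda>\<omega>. \<Sum>i<n. \<omega> i))"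
    by (rule uniform_sequence.real_distribution_distr) measurable
  have "uniform_sequence.indep_vars (\<lambda>_. borel) (\<lambda>i \<omega>. \<omega> i) {..<n}"
    by (rule uniform_sequence.indep_vars_subset[OF indep_vars_uniform_sequence]) simp
  then show "char (distr (sample n) borel (descents_plus_last n)) =
      char (distr uniform_sequence borel (\<lambda>\<omega>. \<Sum>i<n. \<omega> i))"
    by (simp add: fun_eq_iff char_descents_plus_last[OF assms] uniform_sequence.char_distr_sum
        distr_uniform_sequence_coordinate del: One_nat_def)
qed


section \<open>The limit distribution of the degree\<close>

lemma asymp_normal_cyclic_descents_sample:
  "asymp_normal (1/12) (\<lambda>n. distr (sample n) borel (\<lambda>v. real (cyclic_descents n v)))"
proof (rule asymp_normal_perturb)
  show "asymp_normal (1/12) (\<lambda>n. distr (sample n) borel (descents_plus_last n))"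
    by (rule asymp_normal_cong[OF asymp_normal_uniform_sum]) (simp only: distr_descents_plus_last)
  have close: "AE v in sample n. \<bar>descents_plus_last n v - real (cyclic_descents n v)\<bar> \<le> 1" if "n \<ge> 1" for n
    by (rule eventually_mono[OF AE_sample_01[of n "{1..n}"]]) (use that cyclic_descents_close in auto)
  fix n :: nat assume n: "n \<ge> 1"
  interpret S: prob_space "sample n" by (rule prob_space_PiM_unif)
  show "prob_space (sample n)" by (rule prob_space_PiM_unif)
  show [measurable]: "descents_plus_last n \<in> borel_measurable (sample n)" 
    by (rule measurable_descents_plus_last[OF n])
  show [measurable]: "(\<lambda>v. real (cyclic_descents n v)) \<in> borel_measurable (sample n)"
    by (rule measurable_cyclic_descents)
  have cd: "real (cyclic_descents n v) \<le> real n" for v :: "nat \<Rightarrow> real"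
    using cyclic_descents_le[of n v] by simp
  show "integrable (sample n) (\<lambda>v. (real (cyclic_descents n v))\<^sup>2)"
  proof (rule S.integrable_const_bound[where B = "(real n)\<^sup>2"])
    show "AE v in sample n. norm ((real (cyclic_descents n v))\<^sup>2) \<le> (real n)\<^sup>2"
      using cd by (intro AE_I2) (auto intro: power_mono)
  qed measurable
  show "integrable (sample n) (\<lambda>v. (descents_plus_last n v)\<^sup>2)"
  proof (rule S.integrable_const_bound[where B = "(real n + 1)\<^sup>2"])
    show "AE v in sample n. norm ((descents_plus_last n v)\<^sup>2) \<le> (real n + 1)\<^sup>2"
      using close[OF n]
    proof eventually_elim
      case (elim v)
      then have "\<bar>descents_plus_last n v\<bar> \<le> \<bar>real n + 1\<bar>" using cd[of v] by linarith
      then have "(descents_plus_last n v)\<^sup>2 \<le> (real n + 1)\<^sup>2" by (simp only: abs_le_square_iff)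
      then show ?case by simp
    qed
  qed measurable
next
  show "(\<lambda>n. (\<integral>v. (descents_plus_last n v - real (cyclic_descents n v))\<^sup>2 \<partial>sample n) / real n) \<longlonglongrightarrow> 0"
  proof (rule Lim_null_comparison[OF _ lim_1_over_n])
    show "\<forall>\<^sub>F n in sequentially. norm ((\<integral>v. (descents_plus_last n v - real (cyclic_descents n v))\<^sup>2 \<partial>sample n) / real n)
        \<le> 1 / real n"
      using eventually_ge_at_top[of 1]
    proof eventually_elim
      case (elim n)
      interpret S: prob_space "sample n" by (rule prob_space_PiM_unif)
      have "S.expectation (\<lambda>v. (descents_plus_last n v - real (cyclic_descents n v))\<^sup>2) \<le> S.expectation (\<lambda>_. 1)"
      proof (rule integral_mono_AE')
        show "integrable (sample n) (\<lambda>_. 1 :: real)" by (rule S.integrable_const)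
        show "AE v in sample n. (descents_plus_last n v - real (cyclic_descents n v))\<^sup>2 \<le> 1"
          by (rule eventually_mono[OF AE_sample_01[of n "{1..n}"]])
             (use elim cyclic_descents_close in \<open>auto simp: abs_square_le_1\<close>)
      qed auto
      then show ?case by (simp add: S.prob_space divide_right_mono del: One_nat_def)
    qed
  qed
qed simp

text \<open>
  The two marginals of the coupling are compared: the first one has been dealt with through uniform samples,
  and the mean square distance is at most four times the second moment of the number of disagreements.
\<close>
lemma asymp_normal_deg:
  "asymp_normal (1/12) (\<lambda>n. distr (measure_pmf (cycle_pmf n)) borel (\<lambda>\<nu>. real (deg n \<nu>)))"
proof -
  have fst: "distr (measure_pmf (coupling n)) borel (\<lambda>p. real (cyclic_descents n (fst p))) =
      distr (sample n) borel (\<lambda>v. real (cyclic_descents n v))" if "n \<ge> 1" for n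
    unfolding distr_cyclic_descents_sample map_fst_coupling[OF that, symmetric] map_pmf_rep_eq
    by (subst distr_distr) (auto simp: comp_def)
  have snd: "distr (measure_pmf (coupling n)) borel (\<lambda>p. real (cyclic_descents n (snd p))) =
      distr (measure_pmf (cycle_pmf n)) borel (\<lambda>\<nu>. real (deg n \<nu>))" if "n \<ge> 1" for n
    unfolding deg_eq_cyclic_descents map_snd_coupling[OF that, symmetric] map_pmf_rep_eq
    by (subst distr_distr) (auto simp: comp_def)
  have int: "integrable (measure_pmf (coupling n)) f" if "n \<ge> 1" for n and f :: "_ \<Rightarrow> real"
    by (rule integrable_measure_pmf_finite[OF finite_set_pmf_coupling[OF that]])
  have "asymp_normal (1/12) (\<lambda>n. distr (measure_pmf (coupling n)) borel (\<lambda>p. real (cyclic_descents n (snd p))))"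
  proof (rule asymp_normal_perturb)
    show "asymp_normal (1/12) (\<lambda>n. distr (measure_pmf (coupling n)) borel (\<lambda>p. real (cyclic_descents n (fst p))))"
      by (rule asymp_normal_cong[OF asymp_normal_cyclic_descents_sample]) (simp add: fst)
    have lim: "(\<lambda>n. 160 * sqrt (real n) / real n) \<longlonglongrightarrow> 0" by real_asymp
    show "(\<lambda>n. measure_pmf.expectation (coupling n)
        (\<lambda>p. (real (cyclic_descents n (fst p)) - real (cyclic_descents n (snd p)))\<^sup>2) / real n) \<longlonglongrightarrow> 0"
    proof (rule Lim_null_comparison[OF _ lim])
      show "\<forall>\<^sub>F n in sequentially. norm (measure_pmf.expectation (coupling n)
        (\<lambda>p. (real (cyclic_descents n (fst p)) - real (cyclic_descents n (snd p)))\<^sup>2) / real n)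
        \<le> 160 * sqrt (real n) / real n"
        using eventually_ge_at_top[of 1]
      proof eventually_elim
        case (elim n)
        have "measure_pmf.expectation (coupling n)
            (\<lambda>p. (real (cyclic_descents n (fst p)) - real (cyclic_descents n (snd p)))\<^sup>2)
          \<le> measure_pmf.expectation (coupling n) (\<lambda>p. 4 * (real (discrepancy p))\<^sup>2)"
        proof (rule integral_mono_AE[OF int[OF elim] int[OF elim]])
          show "AE p in measure_pmf (coupling n).
            (real (cyclic_descents n (fst p)) - real (cyclic_descents n (snd p)))\<^sup>2 \<le> 4 * (real (discrepancy p))\<^sup>2"
          proof (rule AE_pmfI)
            fix p assume p: "p \<in> set_pmf (coupling n)"
            have "finite {i. fst p i \<noteq> snd p i}"
              using p set_pmf_coupling[OF elim, of "fst p" "snd p"]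
              by (intro finite_disagreements[of _ "{1..n}"]) auto
            from cyclic_descents_diff_le_disagreements[OF this, of n]
            have "\<bar>real (cyclic_descents n (fst p)) - real (cyclic_descents n (snd p))\<bar> \<le> \<bar>2 * real (discrepancy p)\<bar>"
              by simp
            then have "(real (cyclic_descents n (fst p)) - real (cyclic_descents n (snd p)))\<^sup>2 \<le> (2 * real (discrepancy p))\<^sup>2"
              by (simp only: abs_le_square_iff)
            then show "(real (cyclic_descents n (fst p)) - real (cyclic_descents n (snd p)))\<^sup>2 \<le> 4 * (real (discrepancy p))\<^sup>2"
              by (simp add: power_mult_distrib)
          qed
        qed
        also have "\<dots> \<le> 160 * sqrt (real n)"
          using expectation_discrepancy_squared_le[OF elim] by simp
        finally show ?case by (simp add: divide_right_mono)
      qed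
    qed
  qed (auto intro: int measure_pmf.prob_space_axioms)
  then show ?thesis by (rule asymp_normal_cong) (rule snd)
qed

lemma normalized_deg_eq_standardize:
  "normalized_deg n \<nu> = standardize (distr (measure_pmf (cycle_pmf n)) borel (\<lambda>\<nu>. real (deg n \<nu>))) (real (deg n \<nu>))"
  by (subst standardize_distr) (auto simp: normalized_deg_def deg_mean_def deg_variance_def)

lemma weak_conv_normalized_deg:
  "weak_conv_m (\<lambda>n. distr (measure_pmf (cycle_pmf n)) borel (normalized_deg n)) std_normal_distribution"
proof (rule levy_continuity)
  show "real_distribution (distr (measure_pmf (cycle_pmf n)) borel (normalized_deg n))" for n
    by (rule prob_space.real_distribution_distr[OF measure_pmf.prob_space_axioms]) simp
  show "real_distribution std_normal_distribution" by (rule real_dist_normal_dist)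
  fix t
  let ?L = "\<lambda>n. distr (measure_pmf (cycle_pmf n)) borel (\<lambda>\<nu>. real (deg n \<nu>))"
  have "char (distr (measure_pmf (cycle_pmf n)) borel (normalized_deg n)) t =
      (\<integral>x. iexp (t * standardize (?L n) x) \<partial>?L n)" for n
  proof -
    have "char (distr (measure_pmf (cycle_pmf n)) borel (normalized_deg n)) t =
        (\<integral>\<nu>. iexp (t * normalized_deg n \<nu>) \<partial>measure_pmf (cycle_pmf n))"
      unfolding char_def by (rule integral_distr) auto
    also have "\<dots> = (\<integral>\<nu>. iexp (t * standardize (?L n) (real (deg n \<nu>))) \<partial>measure_pmf (cycle_pmf n))"
      by (simp only: normalized_deg_eq_standardize)
    also have "\<dots> = (\<integral>x. iexp (t * standardize (?L n) x) \<partial>?L n)"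
    proof (rule integral_distr[symmetric])
      show "(\<lambda>\<nu>. real (deg n \<nu>)) \<in> measurable (measure_pmf (cycle_pmf n)) borel" by simp
    qed measurable
    finally show ?thesis .
  qed
  then show "(\<lambda>n. char (distr (measure_pmf (cycle_pmf n)) borel (normalized_deg n)) t)
      \<longlonglongrightarrow> char std_normal_distribution t"
    using asymp_normal_deg unfolding asymp_normal_def by simp
qed


section \<open>Positivity of the variance\<close>

definition rotation :: "nat \<Rightarrow> nat \<Rightarrow> nat" where
  "rotation n i = (if i \<in> {1..n} then i mod n + 1 else i)"

lemma rotation_simps:
  "i \<in> {1..<n} \<Longrightarrow> rotation n i = i + 1"
  "n \<ge> 1 \<Longrightarrow> rotation n n = 1"
  by (auto simp: rotation_def)

lemma rotation_in_n_cycles: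
  assumes n: "n \<ge> 2"
  shows "rotation n \<in> n_cycles n"
proof -
  have "inj_on (rotation n) {1..n}"
    using inj_on_cyclic_successor by (rule inj_on_cong[THEN iffD1, rotated]) (simp add: rotation_def)
  moreover have sub: "rotation n ` {1..n} \<subseteq> {1..n}"
  proof
    fix x assume "x \<in> rotation n ` {1..n}"
    then obtain i where i: "i \<in> {1..n}" "x = rotation n i" by blast
    show "x \<in> {1..n}"
      using i rotation_simps(1)[of i n] rotation_simps(2)[of n] n by (cases "i = n") auto
  qed
  ultimately have "bij_betw (rotation n) {1..n} {1..n}"
    by (simp add: bij_betw_def endo_inj_surj)
  then have perm: "rotation n permutes {1..n}"
    by (rule bij_imp_permutes) (auto simp: rotation_def)
  have ge2: "x \<le> n \<longrightarrow> x \<in> orbit (rotation n) 1" if "x \<ge> 2" for x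
    using that
  proof (induction x rule: nat_induct_at_least)
    case base
    show ?case using orbit.base[of "rotation n" 1] n by (simp add: rotation_simps numeral_2_eq_2)
  next
    case (Suc x)
    show ?case
      using Suc orbit.step[of x "rotation n" 1] rotation_simps(1)[of x n] by auto
  qed
  have "1 \<in> orbit (rotation n) 1"
    using orbit.step[of n "rotation n" 1] ge2[of n] n rotation_simps(2)[of n] by simp
  then have "{1..n} \<subseteq> orbit (rotation n) 1"
    using ge2 by (metis One_nat_def Suc_1 atLeastAtMost_iff le_antisym not_less_eq_eq subsetI)
  moreover have "orbit (rotation n) 1 \<subseteq> {1..n}"
    by (rule permutes_orbit_subset[OF perm]) (use n in auto)
  ultimately have "cyclic_on (rotation n) {1..n}"
    using n by (auto simp: cyclic_on_def)
  then show ?thesis using perm by (simp add: n_cycles_def)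
qed

lemma deg_rotation_le: 
  assumes "n \<ge> 2"
  shows "deg n (rotation n) \<le> 1"
proof -
  have "{i \<in> {1..n}. rotation n i > rotation n (i mod n + 1)} \<subseteq> {n - 1}"
  proof
    fix i assume i: "i \<in> {i \<in> {1..n}. rotation n i > rotation n (i mod n + 1)}"
    consider "i = n" | "i + 1 < n" | "i = n - 1" using i by force
    then show "i \<in> {n - 1}"
    proof cases
      case 1
      then show ?thesis using i assms by (simp add: rotation_simps)
    next
      case 2
      then show ?thesis using i by (auto simp: rotation_def)
    qed simp
  qed
  then show ?thesis unfolding deg_def using card_mono[of "{n - 1}"] by fastforce
qed

text \<open>
  The rotation conjugated by the transposition of \<open>1\<close> and \<open>2\<close>: in one-line notation it reads
  \<open>3, 1, 4, \<dots>, n, 2\<close>.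
\<close>
definition twisted_rotation :: "nat \<Rightarrow> nat \<Rightarrow> nat" where
  "twisted_rotation n = Transposition.transpose 1 2 \<circ> rotation n \<circ> Transposition.transpose 1 2"

lemma twisted_rotation_in_n_cycles:
  assumes n: "n \<ge> 2"
  shows "twisted_rotation n \<in> n_cycles n"
proof -
  let ?t = "Transposition.transpose 1 2 :: nat \<Rightarrow> nat"
  have r: "rotation n permutes {1..n}" "cyclic_on (rotation n) {1..n}"
    using rotation_in_n_cycles[OF n] by (auto simp: n_cycles_def)
  have t: "?t permutes {1..n}" by (rule permutes_swap_id) (use n in auto)
  have "cyclic_on (twisted_rotation n) (?t ` {1..n})"
    by (rule cyclic_on_image[OF r(2)]) (simp add: twisted_rotation_def)
  then show ?thesis
    using permutes_image[OF t] permutes_compose[OF permutes_compose[OF t r(1)] t]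
    by (simp add: n_cycles_def twisted_rotation_def o_assoc)
qed

lemma deg_twisted_rotation_ge: 
  assumes n: "n \<ge> 4"
  shows "deg n (twisted_rotation n) \<ge> 2"
proof -
  have v: "twisted_rotation n 1 = 3" "twisted_rotation n 2 = 1"
    "twisted_rotation n (n - 1) = n" "twisted_rotation n n = 2"
    using n by (auto simp: twisted_rotation_def rotation_def Transposition.transpose_def)
  have "{1, n - 1} \<subseteq> {i \<in> {1..n}. twisted_rotation n i > twisted_rotation n (i mod n + 1)}"
  proof -
    have "1 mod n + 1 = 2" "(n - 1) mod n + 1 = n" using n by auto
    then show ?thesis unfolding insert_subset mem_Collect_eq using n v by (auto simp: numeral_2_eq_2)
  qed
  then have "card {1, n - 1} \<le> deg n (twisted_rotation n)"
    unfolding deg_def by (rule card_mono[rotated]) simp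
  moreover have "card {1, n - 1} = 2" using n by (subst card_insert_disjoint) auto
  ultimately show ?thesis by simp
qed

text \<open>
  The degree is not constant on the \<open>n\<close>-cycles: it is at most \<open>1\<close> at the rotation and at least \<open>2\<close> at the
  twisted rotation.
\<close>
lemma deg_variance_pos:
  assumes n: "n \<ge> 4"
  shows "deg_variance n > 0"
proof (rule ccontr)
  assume "\<not> deg_variance n > 0"
  moreover have "deg_variance n \<ge> 0" unfolding deg_variance_def by (rule measure_pmf.variance_positive)
  ultimately have zero: "measure_pmf.expectation (cycle_pmf n) (\<lambda>\<nu>. (real (deg n \<nu>) - deg_mean n)\<^sup>2) = 0"
    by (simp add: deg_variance_def deg_mean_def not_less order_antisym)
  have set: "set_pmf (cycle_pmf n) = n_cycles n"
    unfolding cycle_pmf_def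
    by (rule set_pmf_of_set) (use n n_cycles_nonempty finite_n_cycles in auto)
  have "integrable (measure_pmf (cycle_pmf n)) (\<lambda>\<nu>. (real (deg n \<nu>) - deg_mean n)\<^sup>2)"
    by (rule integrable_measure_pmf_finite) (simp add: set finite_n_cycles)
  then have "AE \<nu> in measure_pmf (cycle_pmf n). (real (deg n \<nu>) - deg_mean n)\<^sup>2 = 0"
    using zero by (subst (asm) integral_nonneg_eq_0_iff_AE) auto
  then have const: "real (deg n \<nu>) = deg_mean n" if "\<nu> \<in> n_cycles n" for \<nu>
    using that by (simp add: AE_measure_pmf_iff set)
  have "real (deg n (rotation n)) = real (deg n (twisted_rotation n))"
    using const[OF rotation_in_n_cycles] const[OF twisted_rotation_in_n_cycles] n by simp
  then show False using deg_rotation_le[of n] deg_twisted_rotation_ge[OF n] n by simp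
qed


section \<open>Convergence in distribution\<close>

theorem theorem1p3:
  shows "(\<forall>n\<ge>5. deg_variance n > 0) \<and>
    weak_conv_m (\<lambda>n. distr (measure_pmf (cycle_pmf n)) borel (normalized_deg n))
      std_normal_distribution"
  using deg_variance_pos weak_conv_normalized_deg by simp

end
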